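(* Let $\Omega\subset\mathbb{R}^2$ be the unit disk and let $\kappa>0$. Then there is a constant $C\ge 1$, depending only on $\kappa$, such that for every real $q\ge 1+\kappa$ and every classical solution $(u_q,v_q)$ of $$-\Delta u_q=v_q,\ u_q>0\text{ in }\Omega,\qquad -\Delta v_q=u_q^q,\ v_q>0\text{ in }\Omega,\qquad u_q=v_q=0\text{ on }\partial\Omega,$$ one has $$\|u_q\|_{L^\infty(\Omega)}\le C\qquad\text{and}\qquad C^{-1}\log(q)\le\|v_q\|_{L^\infty(\Omega)}\le C\log(q).$$
   Context: A classical solution is a pair of functions in $[C^2(\Omega)\cap C(\overline\Omega)]^2$ satisfying the equations, the positivity conditions and the boundary conditions pointwise. In $u_q^q$ the subscript is an index and the superscript is the power. The constant $C$ does not depend on $q$ or on the solution. *)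

theory Defs
  imports "HOL-Analysis.Analysis" "HOL-Probability.Essential_Supremum"
begin

definition has_partial_deriv_at :: "'n::finite \<Rightarrow> (real ^ 'n \<Rightarrow> real) \<Rightarrow> real ^ 'n \<Rightarrow> bool" where
  "has_partial_deriv_at i f x \<longleftrightarrow> (\<lambda>t. f (x + t *\<^sub>R axis i 1)) field_differentiable (at 0)"

definition partial_deriv :: "'n::finite \<Rightarrow> (real ^ 'n \<Rightarrow> real) \<Rightarrow> real ^ 'n \<Rightarrow> real" where
  "partial_deriv i f x = deriv (\<lambda>t. f (x + t *\<^sub>R axis i 1)) 0"

text \<open>The class $C^k(S)$; meant for open \<open>S\<close>, since the partial derivatives are two-sided.
  The values of \<open>f\<close> outside an open \<open>S\<close> are irrelevant.\<close>

primrec C_k_on :: "nat \<Rightarrow> (real ^ 'n::finite) set \<Rightarrow> (real ^ 'n \<Rightarrow> real) \<Rightarrow> bool" where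
  "C_k_on 0 S f \<longleftrightarrow> continuous_on S f"
| "C_k_on (Suc k) S f \<longleftrightarrow> continuous_on S f \<and>
     (\<forall>i. (\<forall>x\<in>S. has_partial_deriv_at i f x) \<and> C_k_on k S (partial_deriv i f))"

definition laplacian :: "(real ^ 'n::finite \<Rightarrow> real) \<Rightarrow> real ^ 'n \<Rightarrow> real" where
  "laplacian f x = (\<Sum>i\<in>UNIV. partial_deriv i (partial_deriv i f) x)"

definition Linf_norm :: "(real ^ 'n::finite) set \<Rightarrow> (real ^ 'n \<Rightarrow> real) \<Rightarrow> ereal" where
  "Linf_norm S f = esssup (lebesgue_on S) (\<lambda>x. ereal \<bar>f x\<bar>)"

abbreviation unit_disk :: "(real ^ 2) set" where
  "unit_disk \<equiv> ball 0 1"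

text \<open>In the second equation the real power \<open>powr\<close> is only applied to the positive number \<open>u x\<close>.\<close>

definition classical_solution ::
  "real \<Rightarrow> (real ^ 'n::finite) set \<Rightarrow> (real ^ 'n \<Rightarrow> real) \<Rightarrow> (real ^ 'n \<Rightarrow> real) \<Rightarrow> bool" where
  "classical_solution q \<Omega> u v \<longleftrightarrow>
     C_k_on 2 \<Omega> u \<and> continuous_on (closure \<Omega>) u \<and>
     C_k_on 2 \<Omega> v \<and> continuous_on (closure \<Omega>) v \<and>
     (\<forall>x\<in>\<Omega>. - laplacian u x = v x \<and> u x > 0) \<and>
     (\<forall>x\<in>\<Omega>. - laplacian v x = u x powr q \<and> v x > 0) \<and>
     (\<forall>x\<in>frontier \<Omega>. u x = 0 \<and> v x = 0)"

end

(* Moving planes show that u and v are radial. The reflected differences satisfy a cooperative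
   linear system, and near the boundary of a cap the sign is obtained from an explicit barrier
   instead of measure estimates. For a radial solution, let m(r) = -r v'(r) be the mass of u^q
   inside radius r. Comparing u(1/2) >= c v(1/2) >= c' m(1/2) >= c'' u(1/2)^q bounds u(1/2) and
   hence the total mass, uniformly in q >= 1 + kappa. This bounds u and u', so max u^q grows at
   most quadratically in q, and v(0) = int m(s)/s ds = O(log q). Conversely u(r) + c r^2 is
   decreasing for r <= 1/2, so a fixed fraction of the mass of u^q sits inside radius
   q^(-1/4)/2, which forces v(0) >= c log q. *)
theory Submission
  imports Defs
begin

section \<open>Laplacians and minimum principles\<close>

text \<open>Two kinds of constants are kept apart. In the moving planes argument, the width of the
  boundary collar and the Lipschitz constant of the power may depend on q and on the solution,
  because only the qualitative conclusion, radial symmetry, is passed on. Everything after that must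
  be uniform in q and is therefore phrased through the mass inside radius 1/2, which is shown to lie
  between 1/4 and a constant depending on \<open>\<kappa>\<close>. The condition q >= 1 +
  \<open>\<kappa>\<close> enters because the chain of comparisons at radius 1/2 closes to u(1/2)^(q
  - 1) <= 256, whose root is uniformly bounded only while q stays away from 1. It also lets log q
  absorb additive constants. The exponent -1/4 is a balance. Between radii rho/2 and rho the profile
  u drops by order rho^2, which gains a factor of order q rho^2 in u^q, and the area contributes
  another rho^2; the product q rho^4 has to be of order one. The power of q itself matters little,
  since the logarithm turns it into a constant factor.\<close>

text \<open>The Laplacian as a limit of second symmetric differences over every orthonormal frame. This
  is visibly invariant under reflections and nonnegative at minima, and no regularity has to be carried along.\<close>

definition lap_at :: "(real^2 \<Rightarrow> real) \<Rightarrow> real^2 \<Rightarrow> real \<Rightarrow> bool" where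
  "lap_at f x l \<longleftrightarrow> (\<forall>e e'. norm e = 1 \<longrightarrow> norm e' = 1 \<longrightarrow> e \<bullet> e' = 0 \<longrightarrow>
     ((\<lambda>h. (f (x + h *\<^sub>R e) + f (x - h *\<^sub>R e) + f (x + h *\<^sub>R e') + f (x - h *\<^sub>R e') - 4 * f x) / h^2)
        \<longlongrightarrow> l) (at 0))"

lemma lap_at_add:
  assumes "lap_at f x l" "lap_at g x k"
  shows "lap_at (\<lambda>x. f x + g x) x (l + k)"
  unfolding lap_at_def
proof (intro allI impI)
  fix e e' :: "real^2" assume e: "norm e = 1" "norm e' = 1" "e \<bullet> e' = 0"
  have "((\<lambda>h. (f (x + h *\<^sub>R e) + f (x - h *\<^sub>R e) + f (x + h *\<^sub>R e') + f (x - h *\<^sub>R e') - 4 * f x) / h^2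
            + (g (x + h *\<^sub>R e) + g (x - h *\<^sub>R e) + g (x + h *\<^sub>R e') + g (x - h *\<^sub>R e') - 4 * g x) / h^2)
        \<longlongrightarrow> l + k) (at 0)"
    using assms e unfolding lap_at_def by (intro tendsto_add) blast+
  then show "((\<lambda>h. (f (x + h *\<^sub>R e) + g (x + h *\<^sub>R e) + (f (x - h *\<^sub>R e) + g (x - h *\<^sub>R e))
      + (f (x + h *\<^sub>R e') + g (x + h *\<^sub>R e')) + (f (x - h *\<^sub>R e') + g (x - h *\<^sub>R e')) - 4 * (f x + g x)) / h^2)
        \<longlongrightarrow> l + k) (at 0)"
    by (rule filterlim_cong[THEN iffD1, rotated -1]) (auto simp: add_divide_distrib diff_divide_distrib algebra_simps)
qed

lemma lap_at_cmult:
  assumes "lap_at f x l"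
  shows "lap_at (\<lambda>x. c * f x) x (c * l)"
  unfolding lap_at_def
proof (intro allI impI)
  fix e e' :: "real^2" assume e: "norm e = 1" "norm e' = 1" "e \<bullet> e' = 0"
  have "((\<lambda>h. c * ((f (x + h *\<^sub>R e) + f (x - h *\<^sub>R e) + f (x + h *\<^sub>R e') + f (x - h *\<^sub>R e') - 4 * f x) / h^2))
        \<longlongrightarrow> c * l) (at 0)"
    using assms e unfolding lap_at_def by (intro tendsto_mult_left) blast
  then show "((\<lambda>h. (c * f (x + h *\<^sub>R e) + c * f (x - h *\<^sub>R e)
      + c * f (x + h *\<^sub>R e') + c * f (x - h *\<^sub>R e') - 4 * (c * f x)) / h^2)
        \<longlongrightarrow> c * l) (at 0)"
    by (rule filterlim_cong[THEN iffD1, rotated -1]) (auto simp: algebra_simps)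
qed

lemma lap_at_diff:
  assumes "lap_at f x l" "lap_at g x k"
  shows "lap_at (\<lambda>x. f x - g x) x (l - k)"
  using lap_at_add[OF assms(1) lap_at_cmult[OF assms(2), of "-1"]] by simp

lemma lap_at_unique:
  assumes "lap_at f x l" "norm e = 1" "norm e' = 1" "e \<bullet> e' = 0"
    "((\<lambda>h. (f (x + h *\<^sub>R e) + f (x - h *\<^sub>R e) + f (x + h *\<^sub>R e') + f (x - h *\<^sub>R e') - 4 * f x) / h^2)
        \<longlongrightarrow> k) (at 0)"
  shows "k = l"
proof (rule tendsto_unique[OF _ assms(5)])
  show "((\<lambda>h. (f (x + h *\<^sub>R e) + f (x - h *\<^sub>R e) + f (x + h *\<^sub>R e') + f (x - h *\<^sub>R e') - 4 * f x) / h^2)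
        \<longlongrightarrow> l) (at 0)"
    using assms(1)[unfolded lap_at_def, rule_format, OF assms(2-4)] .
qed simp

definition reflect :: "real^2 \<Rightarrow> real \<Rightarrow> real^2 \<Rightarrow> real^2" where
  "reflect a \<tau> x = x + (2 * (\<tau> - x \<bullet> a)) *\<^sub>R a"

text \<open>The linear part \<open>?L\<close> of the reflection is orthogonal, so it sends
  orthonormal frames to orthonormal frames. This is where quantifying over every frame pays
  off.\<close>

lemma lap_at_reflect:
  assumes "lap_at f (reflect a \<tau> x) l" "norm a = 1"
  shows "lap_at (\<lambda>x. f (reflect a \<tau> x)) x l"
  unfolding lap_at_def
proof (intro allI impI)
  fix e e' :: "real^2" assume e: "norm e = 1" "norm e' = 1" "e \<bullet> e' = 0"
  let ?L = "\<lambda>e. e - (2 * (e \<bullet> a)) *\<^sub>R a"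
  have a: "a \<bullet> a = 1" using assms(2) by (simp add: norm_eq_1)
  have *: "reflect a \<tau> (x + h *\<^sub>R e) = reflect a \<tau> x + h *\<^sub>R ?L e"
          "reflect a \<tau> (x - h *\<^sub>R e) = reflect a \<tau> x - h *\<^sub>R ?L e" for h e
    by (simp_all add: reflect_def algebra_simps inner_simps scaleR_left_distrib scaleR_left_diff_distrib)
  have inner: "?L e \<bullet> ?L f = e \<bullet> f" for e f
    using a by (simp add: inner_simps algebra_simps inner_commute)
  have "norm (?L e) = 1" "norm (?L e') = 1" "?L e \<bullet> ?L e' = 0"
    using e by (simp_all only: norm_eq_1 inner)
  then show "((\<lambda>h. (f (reflect a \<tau> (x + h *\<^sub>R e)) + f (reflect a \<tau> (x - h *\<^sub>R e))
      + f (reflect a \<tau> (x + h *\<^sub>R e')) + f (reflect a \<tau> (x - h *\<^sub>R e')) - 4 * f (reflect a \<tau> x)) / h^2)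
        \<longlongrightarrow> l) (at 0)"
    using assms(1) unfolding * lap_at_def by blast
qed

text \<open>A frame forms the rows of an orthogonal matrix, so its columns are orthonormal too; the
  expansion of the squares uses only the column relations.\<close>

lemma orthonormal_sum_squares:
  fixes e e' x :: "real^2"
  assumes "norm e = 1" "norm e' = 1" "e \<bullet> e' = 0"
  shows "(x \<bullet> e)^2 + (x \<bullet> e')^2 = (norm x)^2"
proof -
  have 1: "e$1 * e$1 + e$2 * e$2 = 1" "e'$1 * e'$1 + e'$2 * e'$2 = 1" "e$1 * e'$1 + e$2 * e'$2 = 0"
    using assms by (simp_all add: norm_eq_1 inner_vec_def sum_2)
  have "e$1 * e$1 + e'$1 * e'$1 = 1" "e$2 * e$2 + e'$2 * e'$2 = 1" "e$1 * e$2 + e'$1 * e'$2 = 0"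
    using 1 by algebra+
  then have "(x$1 * e$1 + x$2 * e$2)^2 + (x$1 * e'$1 + x$2 * e'$2)^2 = x$1^2 + x$2^2"
    by algebra
  then show ?thesis
    unfolding power2_norm_eq_inner inner_vec_def sum_2 by (simp add: power2_eq_square)
qed

text \<open>L'Hopital is applied just once, because the second derivative is given only at 0. The
  resulting quotient is the average of the difference quotients of \<open>\<phi>'\<close> at 0 taken
  at h and at -h.\<close>

lemma symmetric_second_difference:
  fixes \<phi> \<phi>' :: "real \<Rightarrow> real"
  assumes "\<delta> > 0" and d1: "\<And>t. \<bar>t\<bar> < \<delta> \<Longrightarrow> (\<phi> has_real_derivative \<phi>' t) (at t)"
    and d2: "(\<phi>' has_real_derivative d) (at 0)"
  shows "((\<lambda>h. (\<phi> h + \<phi> (- h) - 2 * \<phi> 0) / h^2) \<longlongrightarrow> d) (at 0)"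
proof (rule lhopital[where f'="\<lambda>h. \<phi>' h - \<phi>' (- h)" and g'="\<lambda>h. 2 * h"])
  have c: "isCont \<phi> 0" using d1[of 0] assms(1) by (auto intro: DERIV_isCont)
  have "((\<lambda>h. \<phi> h + \<phi> (- h) - 2 * \<phi> 0) \<longlongrightarrow> \<phi> 0 + \<phi> (- 0) - 2 * \<phi> 0) (at 0)"
    by (intro tendsto_intros isCont_tendsto_compose[of _ \<phi>]) (use c in auto)
  then show "((\<lambda>h. \<phi> h + \<phi> (- h) - 2 * \<phi> 0) \<longlongrightarrow> 0) (at 0)" by simp
  have "((\<lambda>h::real. h\<^sup>2) \<longlongrightarrow> 0\<^sup>2) (at 0)" by (intro tendsto_intros)
  then show "((\<lambda>h::real. h\<^sup>2) \<longlongrightarrow> 0) (at 0)" by simp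
  show "\<forall>\<^sub>F h::real in at 0. h\<^sup>2 \<noteq> 0" "\<forall>\<^sub>F h::real in at 0. 2 * h \<noteq> 0"
    by (auto simp: eventually_at_filter)
  show "\<forall>\<^sub>F h::real in at 0. ((\<lambda>h. h\<^sup>2) has_real_derivative 2 * h) (at h)"
    by (auto intro!: always_eventually derivative_eq_intros)
  have "\<forall>\<^sub>F h::real in at 0. \<bar>h\<bar> < \<delta>"
    using assms(1) by (auto simp: eventually_at dist_real_def)
  then show "\<forall>\<^sub>F h in at 0. ((\<lambda>h. \<phi> h + \<phi> (- h) - 2 * \<phi> 0) has_real_derivative \<phi>' h - \<phi>' (- h)) (at h)"
  proof eventually_elim
    case (elim h)
    have "((\<lambda>h. \<phi> (- h)) has_real_derivative \<phi>' (- h) * (- 1)) (at h)"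
      by (rule DERIV_chain2[where f=\<phi> and g=uminus]) (use elim d1[of "-h"] in \<open>auto intro!: derivative_eq_intros\<close>)
    then show ?case using d1[of h] elim by (auto intro!: derivative_eq_intros)
  qed
  have l: "((\<lambda>h. (\<phi>' h - \<phi>' 0) / h) \<longlongrightarrow> d) (at 0)"
    using d2 by (simp add: has_field_derivative_iff)
  have "((\<lambda>h. \<phi>' (- h)) has_real_derivative d * (- 1)) (at 0)"
    by (rule DERIV_chain2[where f="\<phi>'" and g=uminus]) (use d2 in \<open>auto intro!: derivative_eq_intros\<close>)
  then have r: "((\<lambda>h. (\<phi>' (- h) - \<phi>' 0) / h) \<longlongrightarrow> - d) (at 0)"
    by (simp add: has_field_derivative_iff)
  have "((\<lambda>h. ((\<phi>' h - \<phi>' 0) / h - (\<phi>' (- h) - \<phi>' 0) / h) / 2) \<longlongrightarrow> (d - (- d)) / 2) (at 0)"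
    by (intro tendsto_divide tendsto_diff l r tendsto_const) auto
  then have "((\<lambda>h. ((\<phi>' h - \<phi>' 0) / h - (\<phi>' (- h) - \<phi>' 0) / h) / 2) \<longlongrightarrow> d) (at 0)"
    by simp
  then show "((\<lambda>h. (\<phi>' h - \<phi>' (- h)) / (2 * h)) \<longlongrightarrow> d) (at 0)"
    by (rule filterlim_cong[THEN iffD1, rotated -1]) (auto simp: eventually_at_filter field_simps)
qed

text \<open>The frame quotient splits into second differences along two lines, with limits
  \<open>E e\<close> and \<open>E e'\<close>. The last hypothesis says that this trace is the same
  for all frames.\<close>

lemma lap_atI:
  fixes f :: "real^2 \<Rightarrow> real" and D :: "real^2 \<Rightarrow> real \<Rightarrow> real" and E :: "real^2 \<Rightarrow> real"
  assumes "\<delta> > 0"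
    and "\<And>e t. norm e = 1 \<Longrightarrow> \<bar>t\<bar> < \<delta> \<Longrightarrow> ((\<lambda>t. f (x + t *\<^sub>R e)) has_real_derivative D e t) (at t)"
    and "\<And>e. norm e = 1 \<Longrightarrow> (D e has_real_derivative E e) (at 0)"
    and "\<And>e e'. norm e = 1 \<Longrightarrow> norm e' = 1 \<Longrightarrow> e \<bullet> e' = 0 \<Longrightarrow> E e + E e' = l"
  shows "lap_at f x l"
  unfolding lap_at_def
proof (intro allI impI)
  fix e e' :: "real^2" assume e: "norm e = 1" "norm e' = 1" "e \<bullet> e' = 0"
  have "((\<lambda>h. (f (x + h *\<^sub>R e) + f (x + (- h) *\<^sub>R e) - 2 * f (x + 0 *\<^sub>R e)) / h^2 +
     (f (x + h *\<^sub>R e') + f (x + (- h) *\<^sub>R e') - 2 * f (x + 0 *\<^sub>R e')) / h^2) \<longlongrightarrow> E e + E e') (at 0)"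
    by (intro tendsto_add symmetric_second_difference[OF assms(1)]) (use e assms(2,3) in auto)
  then show "((\<lambda>h. (f (x + h *\<^sub>R e) + f (x - h *\<^sub>R e) + f (x + h *\<^sub>R e') + f (x - h *\<^sub>R e') - 4 * f x) / h^2)
        \<longlongrightarrow> l) (at 0)"
    unfolding assms(4)[OF e]
    by (rule filterlim_cong[THEN iffD1, rotated -1]) (auto simp: add_divide_distrib diff_divide_distrib algebra_simps)
qed

text \<open>Using the squared distance as the variable keeps the function smooth at the centre and
  makes it a quadratic polynomial along every line. Parseval in the frame then sums the two
  directional terms.\<close>

lemma lap_at_radial:
  assumes F: "\<And>s. (F has_real_derivative F' s) (at s)" "\<And>s. (F' has_real_derivative F'' s) (at s)"
  shows "lap_at (\<lambda>x. F ((norm (x - a))\<^sup>2)) x (4 * (norm (x - a))\<^sup>2 * F'' ((norm (x - a))\<^sup>2) + 4 * F' ((norm (x - a))\<^sup>2))"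
proof (rule lap_atI[where \<delta>=1 and D="\<lambda>e t. F' ((norm (x - a))\<^sup>2 + 2 * t * ((x - a) \<bullet> e) + t\<^sup>2) * (2 * ((x - a) \<bullet> e) + 2 * t)"
      and E="\<lambda>e. F'' ((norm (x - a))\<^sup>2) * (2 * ((x - a) \<bullet> e))\<^sup>2 + F' ((norm (x - a))\<^sup>2) * 2"])
  fix e :: "real^2" and t :: real assume e: "norm e = 1"
  have eq: "(norm (x + t *\<^sub>R e - a))\<^sup>2 = (norm (x - a))\<^sup>2 + 2 * t * ((x - a) \<bullet> e) + t\<^sup>2" for t
  proof -
    have "(norm (x + t *\<^sub>R e - a))\<^sup>2 = (norm ((x - a) + t *\<^sub>R e))\<^sup>2"
      by (simp add: algebra_simps)
    also have "\<dots> = (norm (x - a))\<^sup>2 + 2 * ((x - a) \<bullet> (t *\<^sub>R e)) + (norm (t *\<^sub>R e))\<^sup>2"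
      by (simp only: power2_norm_eq_inner inner_add_left inner_add_right inner_commute[of "t *\<^sub>R e" "x - a"])
    finally show ?thesis using e by simp
  qed
  show "((\<lambda>t. F ((norm (x + t *\<^sub>R e - a))\<^sup>2)) has_real_derivative
         F' ((norm (x - a))\<^sup>2 + 2 * t * ((x - a) \<bullet> e) + t\<^sup>2) * (2 * ((x - a) \<bullet> e) + 2 * t)) (at t)"
    unfolding eq by (rule DERIV_chain2[OF F(1)]) (auto intro!: derivative_eq_intros)
  show "((\<lambda>t. F' ((norm (x - a))\<^sup>2 + 2 * t * ((x - a) \<bullet> e) + t\<^sup>2) * (2 * ((x - a) \<bullet> e) + 2 * t)) has_real_derivative
         F'' ((norm (x - a))\<^sup>2) * (2 * ((x - a) \<bullet> e))\<^sup>2 + F' ((norm (x - a))\<^sup>2) * 2) (at 0)"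
    by (auto intro!: derivative_eq_intros DERIV_chain2[OF F(2)] simp: power2_eq_square)
next
  fix e e' :: "real^2" assume e: "norm e = 1" "norm e' = 1" "e \<bullet> e' = 0"
  show "F'' ((norm (x - a))\<^sup>2) * (2 * ((x - a) \<bullet> e))\<^sup>2 + F' ((norm (x - a))\<^sup>2) * 2 +
       (F'' ((norm (x - a))\<^sup>2) * (2 * ((x - a) \<bullet> e'))\<^sup>2 + F' ((norm (x - a))\<^sup>2) * 2) =
       4 * (norm (x - a))\<^sup>2 * F'' ((norm (x - a))\<^sup>2) + 4 * F' ((norm (x - a))\<^sup>2)"
    unfolding orthonormal_sum_squares[OF e, of "x - a", symmetric]
    by (simp add: power_mult_distrib) (simp add: algebra_simps)
qed auto

lemma lap_at_planar:
  assumes a: "norm a = 1" and G: "\<And>s. (G has_real_derivative G' s) (at s)" "\<And>s. (G' has_real_derivative G'' s) (at s)"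
  shows "lap_at (\<lambda>x. G (x \<bullet> a)) x (G'' (x \<bullet> a))"
proof (rule lap_atI[where \<delta>=1 and D="\<lambda>e t. G' (x \<bullet> a + t * (a \<bullet> e)) * (a \<bullet> e)"
      and E="\<lambda>e. G'' (x \<bullet> a) * (a \<bullet> e)\<^sup>2"])
  fix e :: "real^2" and t :: real assume e: "norm e = 1"
  have eq: "(x + t *\<^sub>R e) \<bullet> a = x \<bullet> a + t * (a \<bullet> e)" for t
    by (simp add: inner_simps inner_commute)
  show "((\<lambda>t. G ((x + t *\<^sub>R e) \<bullet> a)) has_real_derivative G' (x \<bullet> a + t * (a \<bullet> e)) * (a \<bullet> e)) (at t)"
    unfolding eq by (rule DERIV_chain2[OF G(1)]) (auto intro!: derivative_eq_intros)
  show "((\<lambda>t. G' (x \<bullet> a + t * (a \<bullet> e)) * (a \<bullet> e)) has_real_derivative G'' (x \<bullet> a) * (a \<bullet> e)\<^sup>2) (at 0)"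
    by (auto intro!: derivative_eq_intros DERIV_chain2[OF G(2)] simp: power2_eq_square)
next
  fix e e' :: "real^2" assume e: "norm e = 1" "norm e' = 1" "e \<bullet> e' = 0"
  show "G'' (x \<bullet> a) * (a \<bullet> e)\<^sup>2 + G'' (x \<bullet> a) * (a \<bullet> e')\<^sup>2 = G'' (x \<bullet> a)"
    using orthonormal_sum_squares[OF e, of a] a by (simp flip: distrib_left)
qed auto

section \<open>Weak and strong minimum principles\<close>

lemma lap_at_local_min_nonneg:
  assumes "lap_at f x l" "open D" "x \<in> D" and min: "\<And>y. y \<in> D \<Longrightarrow> f x \<le> f y"
  shows "l \<ge> 0"
proof -
  obtain \<delta> where d: "\<delta> > 0" "ball x \<delta> \<subseteq> D" using assms(2,3) open_contains_ball by blast
  have ax: "norm (axis 1 1 :: real^2) = 1" "norm (axis 2 1 :: real^2) = 1" "(axis 1 1 :: real^2) \<bullet> axis 2 1 = 0"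
    by (auto simp: norm_axis_1 inner_axis_axis)
  let ?a = "axis 1 1 :: real^2" and ?b = "axis 2 1 :: real^2"
  have "((\<lambda>h. (f (x + h *\<^sub>R ?a) + f (x - h *\<^sub>R ?a) + f (x + h *\<^sub>R ?b) + f (x - h *\<^sub>R ?b) - 4 * f x) / h^2)
        \<longlongrightarrow> l) (at 0)"
    using assms(1) ax unfolding lap_at_def by blast
  moreover have "\<forall>\<^sub>F h in at 0. 0 \<le> (f (x + h *\<^sub>R ?a) + f (x - h *\<^sub>R ?a) + f (x + h *\<^sub>R ?b) + f (x - h *\<^sub>R ?b) - 4 * f x) / h^2"
  proof -
    have "\<forall>\<^sub>F h::real in at 0. \<bar>h\<bar> < \<delta>"
      using d(1) by (auto simp: eventually_at dist_real_def)
    then show ?thesis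
    proof eventually_elim
      case (elim h)
      have "x + h *\<^sub>R ?a \<in> D" "x - h *\<^sub>R ?a \<in> D" "x + h *\<^sub>R ?b \<in> D" "x - h *\<^sub>R ?b \<in> D"
        using elim d ax by (auto intro!: subsetD[OF d(2)] simp: dist_norm)
      from this[THEN min] show ?case by (intro divide_nonneg_nonneg) auto
    qed
  qed
  ultimately show ?thesis by (rule tendsto_lowerbound) auto
qed

text \<open>Subtracting a small multiple of the squared norm turns a nonpositive Laplacian into a
  strictly negative one, which is impossible at an interior minimum.\<close>

lemma weak_minimum_principle:
  fixes D :: "(real^2) set"
  assumes D: "open D" "bounded D" and cont: "continuous_on (closure D) f"
    and bd: "\<And>x. x \<in> frontier D \<Longrightarrow> f x \<ge> 0"
    and lap: "\<And>x. x \<in> D \<Longrightarrow> f x < 0 \<Longrightarrow> \<exists>l\<le>0. lap_at f x l"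
    and x0: "x0 \<in> closure D"
  shows "f x0 \<ge> 0"
proof (rule ccontr)
  assume neg: "\<not> f x0 \<ge> 0"
  obtain C where C: "C > 0" "\<And>x. x \<in> closure D \<Longrightarrow> norm x \<le> C"
    using D(2) bounded_closure bounded_pos by metis
  \<comment> \<open>Small enough that the perturbation cannot lift the negative value at
    \<open>x0\<close> to zero: \<open>f\<close> is still negative at the minimiser of
    \<open>g\<close>, which therefore lies in \<open>D\<close>.\<close>
  define \<epsilon> where "\<epsilon> = - f x0 / (2 * C^2)"
  have e: "\<epsilon> > 0" "\<epsilon> * C^2 < - f x0"
    using neg C by (auto simp: \<epsilon>_def field_simps)
  define g where "g x = f x - \<epsilon> * (norm (x - 0))\<^sup>2" for x
  have cpt: "compact (closure D)" using D(2) by (simp add: compact_closure)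
  have contg: "continuous_on (closure D) g"
    unfolding g_def by (intro continuous_intros cont)
  have "closure D \<noteq> {}" using x0 by auto
  from continuous_attains_inf[OF cpt this contg]
  obtain y where y: "y \<in> closure D" "\<And>x. x \<in> closure D \<Longrightarrow> g y \<le> g x"
    by auto
  have "f y \<le> g x0 + \<epsilon> * (norm y)\<^sup>2" using y(2)[OF x0] by (simp add: g_def)
  also have "\<epsilon> * (norm y)\<^sup>2 \<le> \<epsilon> * C\<^sup>2"
    using C(2)[OF y(1)] e by (intro mult_left_mono power_mono) auto
  also have "g x0 \<le> f x0" using e by (simp add: g_def)
  finally have "f y < 0" using e by linarith
  then have yD: "y \<in> D" using bd[of y] y(1) D(1) by (force simp: frontier_def interior_open)
  from lap[OF yD \<open>f y < 0\<close>] obtain l where l: "l \<le> 0" "lap_at f y l" by blast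
  have "lap_at (\<lambda>x. id ((norm (x - 0))\<^sup>2)) y (4 * (norm (y - 0))\<^sup>2 * 0 + 4 * 1)"
    by (rule lap_at_radial[where F=id and F'="\<lambda>_. 1" and F''="\<lambda>_. 0"]) (auto intro!: derivative_eq_intros simp: id_def)
  then have "lap_at (\<lambda>x. (norm (x - 0))\<^sup>2) y 4" by simp
  from lap_at_diff[OF l(2) lap_at_cmult[OF this, of \<epsilon>]]
  have "lap_at g y (l - \<epsilon> * 4)" unfolding g_def .
  then have "l - \<epsilon> * 4 \<ge> 0"
    using y(2) closure_subset by (intro lap_at_local_min_nonneg[OF _ D(1) yD]) auto
  then show False using l(1) e(1) by linarith
qed

text \<open>Hopf's barrier argument; \<open>(R\<^sup>2 - \<bar>x - a\<bar>\<^sup>2)\<^sup>k\<close> is subharmonic where \<open>k\<bar>x - a\<bar>\<^sup>2 \<ge> R\<^sup>2\<close>.\<close>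

lemma positivity_spreads_ball:
  assumes r: "0 < r" "r < R" and cont: "continuous_on (cball a R) f"
    and lap: "\<And>x. x \<in> ball a R \<Longrightarrow> \<exists>l\<le>0. lap_at f x l"
    and nonneg: "\<And>x. x \<in> cball a R \<Longrightarrow> f x \<ge> 0"
    and pos: "\<And>x. x \<in> cball a r \<Longrightarrow> f x > 0"
    and x: "x \<in> ball a R"
  shows "f x > 0"
proof (cases "x \<in> cball a r")
  case True
  then show ?thesis using pos by blast
next
  case False
  have "continuous_on (cball a r) f" using r by (intro continuous_on_subset[OF cont]) auto
  then obtain z where z: "z \<in> cball a r" "\<And>y. y \<in> cball a r \<Longrightarrow> f z \<le> f y"
    using continuous_attains_inf[OF compact_cball, of a r f] r by force
  obtain k0 :: nat where k0: "R^2 / r^2 \<le> real k0" using real_arch_simple by blast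
  \<comment> \<open>The choice of \<open>k0\<close> makes the barrier subharmonic outside radius
    \<open>r\<close>; the extra 2 keeps \<open>k - 1\<close> and \<open>k - 2\<close> clear of
    truncated subtraction.\<close>
  define k where "k = k0 + 2"
  have kk: "R^2 \<le> real k * r^2" 
  proof -
    have "R^2 \<le> real k0 * r^2" using k0 r by (simp add: pos_divide_le_eq)
    also have "\<dots> \<le> real k * r^2" by (intro mult_right_mono) (auto simp: k_def)
    finally show ?thesis .
  qed
  \<comment> \<open>Scaled so that the barrier stays below the minimum \<open>f z\<close> on the
    inner sphere; on the outer sphere it vanishes.\<close>
  define c where "c = f z / (R^2)^k"
  have c: "c > 0" using pos[OF z(1)] r by (simp add: c_def)
  define F where "F s = c * (R^2 - s)^k" for s :: real
  define F' where "F' s = - c * real k * (R^2 - s)^(k - 1)" for s :: real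
  define F'' where "F'' s = c * real k * real (k - 1) * (R^2 - s)^(k - 2)" for s :: real
  have pow: "((\<lambda>s. (R^2 - s)^j) has_real_derivative - real j * (R^2 - s)^(j - 1)) (at s)" for j s
    by (auto intro!: derivative_eq_intros)
  have dF: "(F has_real_derivative F' s) (at s)" for s
    unfolding F_def F'_def by (rule DERIV_cong[OF DERIV_cmult[OF pow]]) simp
  have dF': "(F' has_real_derivative F'' s) (at s)" for s
    unfolding F'_def F''_def by (rule DERIV_cong[OF DERIV_cmult[OF pow]]) (simp add: numeral_2_eq_2)
  have lapF: "lap_at (\<lambda>x. F ((norm (x - a))\<^sup>2)) x (4 * (norm (x - a))\<^sup>2 * F'' ((norm (x - a))\<^sup>2) + 4 * F' ((norm (x - a))\<^sup>2))" for x
    by (rule lap_at_radial[OF dF dF'])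
  let ?D = "ball a R - cball a r"
  let ?g = "\<lambda>x. f x - F ((norm (x - a))\<^sup>2)"
  have sub: "closure ?D \<subseteq> cball a R - ball a r"
    by (rule closure_minimal) (auto intro: closed_Diff)
  have "?g x \<ge> 0"
  proof (rule weak_minimum_principle[where D="?D" and f="?g"])
    show "open ?D" by (intro open_Diff) auto
    show "bounded ?D" by (rule bounded_subset[of "ball a R"]) auto
    show "continuous_on (closure ?D) ?g" unfolding F_def
      using sub by (intro continuous_intros continuous_on_subset[OF cont]) auto
    show "x \<in> closure ?D" using False x by (intro subsetD[OF closure_subset]) auto
  next
    fix y assume y: "y \<in> frontier ?D"
    have y': "y \<in> cball a R - ball a r" using y sub by (auto simp: frontier_def)
    have "y \<notin> ?D" using y by (simp add: frontier_def interior_open open_Diff)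
    then consider "norm (y - a) = R" | "norm (y - a) = r"
      using y' by (force simp: dist_norm norm_minus_commute)
    then show "?g y \<ge> 0"
    proof cases
      case 1
      then show ?thesis using nonneg[of y] y' by (simp add: F_def k_def)
    next
      case 2
      have "F ((norm (y - a))\<^sup>2) \<le> c * (R^2)^k"
        unfolding F_def using 2 r c by (intro mult_left_mono power_mono) (auto intro!: power_mono)
      also have "\<dots> = f z" using r by (simp add: c_def)
      also have "\<dots> \<le> f y" using 2 by (intro z(2)) (auto simp: dist_norm norm_minus_commute)
      finally show ?thesis by simp
    qed
  next
    fix y assume y: "y \<in> ?D"
    define s where "s = (norm (y - a))\<^sup>2"
    have s: "r^2 \<le> s" "s \<le> R^2"
      using y r by (auto simp: s_def dist_norm norm_minus_commute intro!: power_mono)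
    have "4 * s * F'' s + 4 * F' s = 4 * c * real k * (R^2 - s)^(k - 2) * (real k * s - R^2)"
      unfolding F''_def F'_def k_def by (simp add: algebra_simps)
    also have "\<dots> \<ge> 0"
    proof -
      have "real k * r^2 \<le> real k * s" using s by (intro mult_left_mono) auto
      then show ?thesis using kk s c by (intro mult_nonneg_nonneg) auto
    qed
    finally have F_sub: "4 * s * F'' s + 4 * F' s \<ge> 0" .
    obtain l where l: "l \<le> 0" "lap_at f y l" using lap[of y] y by auto
    have "lap_at ?g y (l - (4 * s * F'' s + 4 * F' s))"
      unfolding s_def by (rule lap_at_diff[OF l(2) lapF])
    then show "\<exists>l\<le>0. lap_at ?g y l"
      using F_sub l(1) by (intro exI[of _ "l - (4 * s * F'' s + 4 * F' s)"]) simp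
  qed
  moreover have "F ((norm (x - a))\<^sup>2) > 0"
  proof -
    have "(norm (x - a))\<^sup>2 < R^2"
      using x by (intro power_strict_mono) (auto simp: dist_norm norm_minus_commute)
    then show ?thesis using c by (simp add: F_def)
  qed
  ultimately show ?thesis by simp
qed

text \<open>The zero set is open: a positive point close to a zero would spread positivity over a
  ball containing that zero. The domain is thus split into two disjoint open sets, and connectedness
  leaves only the positive one.\<close>

lemma strong_minimum_principle:
  assumes D: "open D" "connected D" and cont: "continuous_on D f"
    and lap: "\<And>x. x \<in> D \<Longrightarrow> \<exists>l\<le>0. lap_at f x l"
    and nonneg: "\<And>x. x \<in> D \<Longrightarrow> f x \<ge> 0"
    and x0: "x0 \<in> D" "f x0 > 0" and x: "x \<in> D"
  shows "f x > 0"
proof -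
  let ?P = "{x \<in> D. f x > 0}" and ?Q = "{x \<in> D. f x = 0}"
  have P: "open ?P"
  proof -
    have "open (f -` {0<..} \<inter> D)"
      using cont unfolding continuous_on_open_vimage[OF D(1)] by simp
    moreover have "?P = f -` {0<..} \<inter> D" by auto
    ultimately show ?thesis by simp
  qed
  have "open ?Q"
  proof (subst open_subopen, intro ballI)
    fix y assume y: "y \<in> ?Q"
    obtain s0 where s0: "s0 > 0" "ball y s0 \<subseteq> D" using D(1) y open_contains_ball by blast
    \<comment> \<open>For \<open>a\<close> within \<open>s\<close> of \<open>y\<close>, the ball of
      radius 2 \<open>s\<close> about \<open>a\<close> contains \<open>y\<close> and stays within
      distance 3 \<open>s\<close> of it, hence inside \<open>D\<close>.\<close>
    define s where "s = s0 / 4"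
    have s: "s > 0" "ball y (4 * s) \<subseteq> D" using s0 by (auto simp: s_def)
    have "ball y s \<subseteq> ?Q"
    proof (rule ccontr)
      assume "\<not> ball y s \<subseteq> ?Q"
      then obtain a where a: "a \<in> ball y s" "a \<notin> ?Q" by blast
      have aD: "a \<in> D" using a s by (intro subsetD[OF s(2)]) auto
      then have "a \<in> ?P" using a nonneg[of a] by force
      then obtain r0 where r0: "r0 > 0" "cball a r0 \<subseteq> ?P" using P open_contains_cball by blast
      define r where "r = min r0 s"
      have sub: "cball a (2 * s) \<subseteq> D"
      proof
        fix b assume "b \<in> cball a (2 * s)"
        then have "dist y b < 4 * s" using a s dist_triangle[of y b a] by auto
        then show "b \<in> D" using s(2) by auto
      qed
      have "f y > 0"
      proof (rule positivity_spreads_ball[where r=r and R="2 * s" and a=a and f=f])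
        show "continuous_on (cball a (2 * s)) f" using sub by (intro continuous_on_subset[OF cont])
        show "y \<in> ball a (2 * s)" using a s by (auto simp: dist_commute)
        show "\<exists>l\<le>0. lap_at f b l" if "b \<in> ball a (2 * s)" for b
          using that sub ball_subset_cball by (intro lap) blast
        show "\<And>x. x \<in> cball a r \<Longrightarrow> 0 < f x" using r0 by (force simp: r_def)
      qed (use r0 s sub nonneg in \<open>auto simp: r_def\<close>)
      then show False using y by simp
    qed
    then show "\<exists>T. open T \<and> y \<in> T \<and> T \<subseteq> ?Q" using s by (intro exI[of _ "ball y s"]) auto
  qed
  moreover have "D \<subseteq> ?P \<union> ?Q" using nonneg by force
  ultimately have "?P \<inter> D = {} \<or> ?Q \<inter> D = {}"
    using P by (intro connectedD[OF D(2)]) auto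
  then show ?thesis using x0 x nonneg[OF x] by force
qed

section \<open>Moving planes\<close>

text \<open>The Lipschitz constant of the power on (0, \<open>M\<close>], where its derivative is
  largest at \<open>M\<close>. It linearises the second equation where the reflected difference of u
  is negative.\<close>

lemma powr_diff_le:
  fixes s t M q :: real
  assumes "0 < s" "s \<le> t" "t \<le> M" "q \<ge> 1"
  shows "t powr q - s powr q \<le> q * M powr (q - 1) * (t - s)"
proof -
  have "q * M powr (q - 1) * s - s powr q \<le> q * M powr (q - 1) * t - t powr q"
  proof (rule DERIV_nonneg_imp_increasing_open[where f="\<lambda>x. q * M powr (q - 1) * x - x powr q", OF assms(2)])
    fix x assume x: "s < x" "x < t"
    have "((\<lambda>x. q * M powr (q - 1) * x - x powr q) has_real_derivative q * M powr (q - 1) - q * x powr (q - 1)) (at x)"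
      using x assms by (auto intro!: derivative_eq_intros)
    moreover have "q * x powr (q - 1) \<le> q * M powr (q - 1)"
      using x assms by (intro mult_left_mono powr_mono2) auto
    ultimately show "\<exists>y. ((\<lambda>x. q * M powr (q - 1) * x - x powr q) has_real_derivative y) (at x) \<and> 0 \<le> y"
      by force
  qed (use assms in \<open>auto intro!: continuous_intros\<close>)
  then show ?thesis by (simp add: algebra_simps)
qed

section \<open>Caps of the disk and reflection across their chords\<close>

definition cap :: "real^2 \<Rightarrow> real \<Rightarrow> (real^2) set" where
  "cap a \<tau> = {x \<in> ball 0 1. x \<bullet> a > \<tau>}"

definition closed_cap :: "real^2 \<Rightarrow> real \<Rightarrow> (real^2) set" where
  "closed_cap a \<tau> = {x \<in> cball 0 1. x \<bullet> a \<ge> \<tau>}"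

lemma open_cap: "open (cap a \<tau>)"
proof -
  have "cap a \<tau> = ball 0 1 \<inter> {x. \<tau> < x \<bullet> a}" by (auto simp: cap_def)
  then show ?thesis by (auto intro!: open_Int open_Collect_less continuous_intros)
qed

lemma convex_cap: "convex (cap a \<tau>)"
proof -
  have "cap a \<tau> = ball 0 1 \<inter> {x. a \<bullet> x > \<tau>}" by (auto simp: cap_def inner_commute)
  then show ?thesis using convex_halfspace_gt[of \<tau> a] by (auto intro!: convex_Int)
qed

lemma compact_closed_cap: "compact (closed_cap a \<tau>)"
proof -
  have "closed_cap a \<tau> = cball 0 1 \<inter> {x. \<tau> \<le> x \<bullet> a}" by (auto simp: closed_cap_def)
  then show ?thesis by (auto intro!: compact_Int_closed closed_Collect_le continuous_intros)
qed

lemma cap_subset_closed_cap: "cap a \<tau> \<subseteq> closed_cap a \<tau>"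
  by (auto simp: cap_def closed_cap_def)

text \<open>The squared norm changes by -4 \<open>\<tau>\<close>
  (\<open>x \<bullet> a - \<tau>\<close>). Hence a cap cut off by a line at nonnegative height is
  reflected into the disk.\<close>

lemma norm_reflect_le:
  assumes "norm a = 1" "0 \<le> \<tau>" "\<tau> \<le> x \<bullet> a"
  shows "norm (reflect a \<tau> x) \<le> norm x"
proof -
  have "a \<bullet> a = 1" using assms(1) by (simp add: norm_eq_1)
  then have "(norm (reflect a \<tau> x))\<^sup>2 = (norm x)\<^sup>2 - 4 * \<tau> * (x \<bullet> a - \<tau>)"
    unfolding power2_norm_eq_inner reflect_def
    by (simp add: inner_simps inner_commute algebra_simps)
  also have "\<dots> \<le> (norm x)\<^sup>2" using assms by simp
  finally show ?thesis by (rule power2_le_imp_le) simp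
qed

lemma dist_reflect:
  assumes "norm a = 1"
  shows "dist (reflect a \<tau> x) (reflect a \<sigma> x) = 2 * \<bar>\<tau> - \<sigma>\<bar>"
proof -
  have "reflect a \<tau> x - reflect a \<sigma> x = (2 * (\<tau> - \<sigma>)) *\<^sub>R a"
    by (simp add: reflect_def algebra_simps)
  then show ?thesis unfolding dist_norm by (simp only: norm_scaleR assms abs_mult)
qed

lemma inner_le_one:
  fixes a x :: "real^2"
  shows "norm a = 1 \<Longrightarrow> norm x \<le> 1 \<Longrightarrow> x \<bullet> a \<le> 1"
  using norm_cauchy_schwarz[of x a] by simp

lemma reflect_fixed: "x \<bullet> a = \<tau> \<Longrightarrow> reflect a \<tau> x = x"
  by (simp add: reflect_def)

text \<open>A small positive function whose negative Laplacian is at least 1 near the boundary of the cap: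
  \<open>c(1 - \<bar>x\<bar>\<^sup>2\<^sup>j)\<close> handles the circular arc and \<open>c(1 - (1 + \<tau> - x \<bullet> a)\<^sup>2\<^sup>j)\<close> the chord, with \<open>j\<close> large.
  It replaces the maximum principle in domains of small measure.\<close>

lemma thin_barrier:
  fixes \<epsilon> :: real and a :: "real^2"
  assumes "\<epsilon> > 0" and a: "norm a = 1"
  obtains \<delta> where "0 < \<delta>" "\<delta> < 1"
    "\<And>\<tau>. 0 \<le> \<tau> \<Longrightarrow> \<tau> < 1 \<Longrightarrow> \<exists>\<psi>. continuous_on UNIV \<psi> \<and> (\<forall>x\<in>closed_cap a \<tau>. 0 \<le> \<psi> x \<and> \<psi> x \<le> \<epsilon>) \<and>
       (\<forall>x\<in>cap a \<tau>. (norm x)\<^sup>2 > 1 - \<delta> \<or> x \<bullet> a < \<tau> + \<delta> \<longrightarrow> (\<exists>k\<ge>1. lap_at \<psi> x (- k)))"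
proof -
  define c where "c = \<epsilon> / 2"
  have c: "c > 0" using assms by (simp add: c_def)
  obtain j0 :: nat where j0: "1 / c \<le> real j0" using real_arch_simple by blast
  \<comment> \<open>Two derivatives bring out a factor of order \<open>j\<close>^2, which beats the
    small amplitude \<open>c\<close>: here \<open>c\<close> \<open>j\<close> >= 1, so
    \<open>c\<close> \<open>j\<close>^2 >= 2. The added 2 again protects the exponents.\<close>
  define j where "j = j0 + 2"
  have cj: "c * real j \<ge> 1"
  proof -
    have "1 \<le> c * real j0" using j0 c by (simp add: field_simps)
    also have "\<dots> \<le> c * real j" using c by (intro mult_left_mono) (auto simp: j_def)
    finally show ?thesis .
  qed
  have j: "real j \<ge> 2" by (simp add: j_def)
  \<comment> \<open>By Bernoulli, every power that occurs is at least 1/2 when its base is at least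
    1 - \<open>\<delta>\<close>. This width is fixed before \<open>\<tau>\<close> and thus serves
    all caps at once.\<close>
  define \<delta> where "\<delta> = 1 / (4 * real j)"
  have d: "0 < \<delta>" "\<delta> < 1" using j by (auto simp: \<delta>_def)
  have half2: "(1 - \<delta>)^(2 * j - 2) \<ge> 1/2"
  proof -
    have "1 - real (2 * j - 2) * \<delta> \<le> (1 - \<delta>)^(2 * j - 2)"
      using Bernoulli_inequality[of "- \<delta>" "2 * j - 2"] d by simp
    moreover have "real (2 * j - 2) * \<delta> \<le> 1/2"
      using j by (simp add: \<delta>_def of_nat_diff field_simps)
    ultimately show ?thesis by linarith
  qed
  have half1: "(1 - \<delta>)^(j - 1) \<ge> 1/2"
  proof -
    have "(1 - \<delta>)^(2 * j - 2) \<le> (1 - \<delta>)^(j - 1)"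
      by (rule power_decreasing) (use d in auto)
    then show ?thesis using half2 by linarith
  qed
  show thesis
  proof
    fix \<tau> :: real assume \<tau>: "0 \<le> \<tau>" "\<tau> < 1"
    define F where "F s = c * (1 - s^j)" for s :: real
    define F' where "F' s = - c * real j * s^(j - 1)" for s :: real
    define F'' where "F'' s = - c * real j * real (j - 1) * s^(j - 2)" for s :: real
    have pow: "((\<lambda>s. s^i) has_real_derivative real i * s^(i - 1)) (at s)" for i s
      by (auto intro!: derivative_eq_intros)
    have dF: "(F has_real_derivative F' s) (at s)" for s
      unfolding F_def F'_def by (rule DERIV_cong[OF DERIV_cmult[OF DERIV_diff[OF DERIV_const pow]]]) simp
    have dF': "(F' has_real_derivative F'' s) (at s)" for s
      unfolding F'_def F''_def by (rule DERIV_cong[OF DERIV_cmult[OF pow]]) (simp add: numeral_2_eq_2)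
    have lapF: "lap_at (\<lambda>x. F ((norm x)\<^sup>2)) x (- (4 * c * (real j)^2 * ((norm x)\<^sup>2)^(j - 1)))" for x
    proof -
      have "4 * s * F'' s + 4 * F' s = - (4 * c * (real j)^2 * s^(j - 1))" for s
        unfolding F''_def F'_def j_def by (simp add: algebra_simps power2_eq_square)
      then show ?thesis using lap_at_radial[OF dF dF', of 0 x] by simp
    qed
    \<comment> \<open>The base 1 + \<open>\<tau>\<close> - p equals 1 on the chord and stays between
      0 and 1 on the closed cap, so the estimates near the chord mirror those near the arc.\<close>
    define G where "G p = c * (1 - (1 + \<tau> - p)^(2 * j))" for p :: real
    define G' where "G' p = c * real (2 * j) * (1 + \<tau> - p)^(2 * j - 1)" for p :: real
    define G'' where "G'' p = - (c * real (2 * j) * real (2 * j - 1) * (1 + \<tau> - p)^(2 * j - 2))" for p :: real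
    have pow': "((\<lambda>p. (1 + \<tau> - p)^i) has_real_derivative - real i * (1 + \<tau> - p)^(i - 1)) (at p)" for i p
      by (auto intro!: derivative_eq_intros)
    have dG: "(G has_real_derivative G' s) (at s)" for s
      unfolding G_def G'_def by (rule DERIV_cong[OF DERIV_cmult[OF DERIV_diff[OF DERIV_const pow']]]) simp
    have dG': "(G' has_real_derivative G'' s) (at s)" for s
      unfolding G'_def G''_def by (rule DERIV_cong[OF DERIV_cmult[OF pow']]) (simp add: numeral_2_eq_2)
    have lapG: "lap_at (\<lambda>x. G (x \<bullet> a)) x (G'' (x \<bullet> a))" for x
      by (rule lap_at_planar[OF a dG dG'])
    show "\<exists>\<psi>. continuous_on UNIV \<psi> \<and> (\<forall>x\<in>closed_cap a \<tau>. 0 \<le> \<psi> x \<and> \<psi> x \<le> \<epsilon>) \<and>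
       (\<forall>x\<in>cap a \<tau>. (norm x)\<^sup>2 > 1 - \<delta> \<or> x \<bullet> a < \<tau> + \<delta> \<longrightarrow> (\<exists>k\<ge>1. lap_at \<psi> x (- k)))"
    proof (intro exI[of _ "\<lambda>x. F ((norm x)\<^sup>2) + G (x \<bullet> a)"] conjI ballI impI)
      show "continuous_on UNIV (\<lambda>x. F ((norm x)\<^sup>2) + G (x \<bullet> a))"
        unfolding F_def G_def by (intro continuous_intros)
    next
      fix x assume x: "x \<in> closed_cap a \<tau>"
      have "x \<bullet> a \<le> 1"
        using inner_le_one[OF a, of x] x by (simp add: closed_cap_def)
      then have p: "0 \<le> 1 + \<tau> - x \<bullet> a" "1 + \<tau> - x \<bullet> a \<le> 1"
        using x \<tau> by (auto simp: closed_cap_def)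
      have s: "0 \<le> (norm x)\<^sup>2" "(norm x)\<^sup>2 \<le> 1"
        using x by (auto simp: closed_cap_def power_le_one)
      have "0 \<le> F ((norm x)\<^sup>2)" "F ((norm x)\<^sup>2) \<le> c * 1"
        unfolding F_def using c s by (auto intro!: mult_nonneg_nonneg mult_left_mono simp: power_le_one)
      moreover have "0 \<le> G (x \<bullet> a)" "G (x \<bullet> a) \<le> c * 1"
        unfolding G_def using c p by (auto intro!: mult_nonneg_nonneg mult_left_mono simp: power_le_one)
      ultimately show "0 \<le> F ((norm x)\<^sup>2) + G (x \<bullet> a)" "F ((norm x)\<^sup>2) + G (x \<bullet> a) \<le> \<epsilon>"
        by (auto simp: c_def)
    next
      fix x assume x: "x \<in> cap a \<tau>" and region: "(norm x)\<^sup>2 > 1 - \<delta> \<or> x \<bullet> a < \<tau> + \<delta>"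
      define k1 where "k1 = 4 * c * (real j)^2 * ((norm x)\<^sup>2)^(j - 1)"
      define k2 where "k2 = - G'' (x \<bullet> a)"
      have lap: "lap_at (\<lambda>x. F ((norm x)\<^sup>2) + G (x \<bullet> a)) x (- (k1 + k2))"
        using lap_at_add[OF lapF[of x] lapG[of x]] by (simp add: k1_def k2_def)
      have cjj: "c * (real j)^2 \<ge> 2"
      proof -
        have "1 * 2 \<le> (c * real j) * real j" using cj j by (intro mult_mono) auto
        then show ?thesis by (simp add: power2_eq_square)
      qed
      have "x \<bullet> a \<le> 1"
        using inner_le_one[OF a, of x] x by (simp add: cap_def)
      then have p: "0 \<le> 1 + \<tau> - x \<bullet> a" using \<tau> by simp
      have "k1 \<ge> 0" unfolding k1_def using c by simp
      moreover have k2: "k2 \<ge> 0" unfolding k2_def G''_def using c p by simp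
      moreover have "k1 \<ge> 1 \<or> k2 \<ge> 1"
        using region
      proof
        assume "(norm x)\<^sup>2 > 1 - \<delta>"
        then have "((norm x)\<^sup>2)^(j - 1) \<ge> (1 - \<delta>)^(j - 1)" using d by (intro power_mono) auto
        then have "((norm x)\<^sup>2)^(j - 1) \<ge> 1/2" using half1 by linarith
        then have "(4 * (c * (real j)^2)) * ((norm x)\<^sup>2)^(j - 1) \<ge> (4 * 2) * (1/2)"
          using cjj by (intro mult_mono) auto
        then show ?thesis by (simp add: k1_def algebra_simps)
      next
        assume "x \<bullet> a < \<tau> + \<delta>"
        then have "(1 + \<tau> - x \<bullet> a)^(2 * j - 2) \<ge> (1 - \<delta>)^(2 * j - 2)" using d by (intro power_mono) auto
        then have *: "(1 + \<tau> - x \<bullet> a)^(2 * j - 2) \<ge> 1/2" using half2 by linarith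
        have "c * real (2 * j) * real (2 * j - 1) \<ge> c * real (2 * j) * real j"
          using c j by (intro mult_left_mono) auto
        moreover have "c * real (2 * j) * real j = 2 * (c * (real j)^2)"
          by (simp add: power2_eq_square)
        ultimately have four: "c * real (2 * j) * real (2 * j - 1) \<ge> 4"
          using cjj by linarith
        then have nn: "0 \<le> c * real (2 * j) * real (2 * j - 1)" by linarith
        have "(c * real (2 * j) * real (2 * j - 1)) * (1 + \<tau> - x \<bullet> a)^(2 * j - 2) \<ge> 4 * (1/2)"
          by (rule mult_mono[OF four * nn]) simp
        then have "k2 \<ge> 1" unfolding k2_def G''_def by linarith
        then show ?thesis ..
      qed
      ultimately have "k1 + k2 \<ge> 1" by linarith
      with lap show "\<exists>k\<ge>1. lap_at (\<lambda>x. F ((norm x)\<^sup>2) + G (x \<bullet> a)) x (- k)" by blast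
    qed
  qed (use d in auto)
qed

section \<open>The coupled system and its reflected differences\<close>

locale disk_solution =
  fixes q :: real and u v :: "real^2 \<Rightarrow> real"
  assumes q: "q > 1"
    and cont_u: "continuous_on (cball 0 1) u" and cont_v: "continuous_on (cball 0 1) v"
    and lap_u: "\<And>x. x \<in> ball 0 1 \<Longrightarrow> lap_at u x (- v x)"
    and lap_v: "\<And>x. x \<in> ball 0 1 \<Longrightarrow> lap_at v x (- (u x powr q))"
    and u_pos: "\<And>x. x \<in> ball 0 1 \<Longrightarrow> u x > 0" and v_pos: "\<And>x. x \<in> ball 0 1 \<Longrightarrow> v x > 0"
    and u_0: "\<And>x. norm x = 1 \<Longrightarrow> u x = 0" and v_0: "\<And>x. norm x = 1 \<Longrightarrow> v x = 0"

locale moving_plane = disk_solution +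
  fixes a :: "real^2"
  assumes norm_a: "norm a = 1"
begin

definition gap :: "(real^2 \<Rightarrow> real) \<Rightarrow> real \<Rightarrow> real^2 \<Rightarrow> real" where
  "gap f \<tau> x = f (reflect a \<tau> x) - f x"

definition ordered :: "real \<Rightarrow> bool" where
  "ordered \<tau> \<longleftrightarrow> (\<forall>x\<in>cap a \<tau>. gap u \<tau> x \<ge> 0 \<and> gap v \<tau> x \<ge> 0)"

lemma a_a: "a \<bullet> a = 1"
  using norm_a by (simp add: norm_eq_1)

lemma u_nonneg: "x \<in> cball 0 1 \<Longrightarrow> u x \<ge> 0"
  using u_pos[of x] u_0[of x] by (cases "norm x = 1") (auto intro: less_imp_le)

lemma v_nonneg: "x \<in> cball 0 1 \<Longrightarrow> v x \<ge> 0"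
  using v_pos[of x] v_0[of x] by (cases "norm x = 1") (auto intro: less_imp_le)

lemma reflect_closed_cap: "0 \<le> \<tau> \<Longrightarrow> x \<in> closed_cap a \<tau> \<Longrightarrow> reflect a \<tau> x \<in> cball 0 1"
  using norm_reflect_le[OF norm_a, of \<tau> x] by (auto simp: closed_cap_def)

lemma reflect_cap: "0 \<le> \<tau> \<Longrightarrow> x \<in> cap a \<tau> \<Longrightarrow> reflect a \<tau> x \<in> ball 0 1"
  using norm_reflect_le[OF norm_a, of \<tau> x] by (auto simp: cap_def)

lemma continuous_gap:
  assumes "continuous_on (cball 0 1) f" "0 \<le> \<tau>"
  shows "continuous_on (closed_cap a \<tau>) (gap f \<tau>)"
proof -
  have "continuous_on (closed_cap a \<tau>) (\<lambda>x. f (reflect a \<tau> x))"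
  proof (rule continuous_on_compose2[OF assms(1)])
    show "continuous_on (closed_cap a \<tau>) (reflect a \<tau>)"
      unfolding reflect_def by (intro continuous_intros)
  qed (use reflect_closed_cap assms in auto)
  moreover have "continuous_on (closed_cap a \<tau>) f"
    by (rule continuous_on_subset[OF assms(1)]) (auto simp: closed_cap_def)
  ultimately show ?thesis unfolding gap_def by (intro continuous_intros)
qed

text \<open>On the arc the subtracted value is zero and the reflected one is nonnegative; on the
  chord the reflection fixes the point.\<close>

lemma gap_boundary_nonneg:
  assumes "0 \<le> \<tau>" "x \<in> closed_cap a \<tau> - cap a \<tau>"
  shows "gap u \<tau> x \<ge> 0" "gap v \<tau> x \<ge> 0"
proof -
  consider "norm x = 1" | "x \<bullet> a = \<tau>"
    using assms by (force simp: closed_cap_def cap_def)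
  then show "gap u \<tau> x \<ge> 0" "gap v \<tau> x \<ge> 0"
    using u_nonneg[OF reflect_closed_cap[of \<tau> x]] v_nonneg[OF reflect_closed_cap[of \<tau> x]] assms
      u_0[of x] v_0[of x] reflect_fixed[of x a \<tau>]
    by (cases; simp add: gap_def)+
qed

lemma lap_gap_u:
  assumes "0 \<le> \<tau>" "x \<in> cap a \<tau>"
  shows "lap_at (gap u \<tau>) x (- gap v \<tau> x)"
proof -
  have "x \<in> ball 0 1" using assms by (simp add: cap_def)
  from lap_at_diff[OF lap_at_reflect[OF lap_u[OF reflect_cap[OF assms]] norm_a] lap_u[OF this]]
  show ?thesis by (simp add: gap_def[abs_def])
qed

lemma lap_gap_v:
  assumes "0 \<le> \<tau>" "x \<in> cap a \<tau>"
  shows "lap_at (gap v \<tau>) x (- (u (reflect a \<tau> x) powr q - u x powr q))"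
proof -
  have "x \<in> ball 0 1" using assms by (simp add: cap_def)
  from lap_at_diff[OF lap_at_reflect[OF lap_v[OF reflect_cap[OF assms]] norm_a] lap_v[OF this]]
  show ?thesis by (simp add: gap_def[abs_def])
qed

lemma u_powr_mono:
  assumes "0 \<le> \<tau>" "x \<in> cap a \<tau>" "gap u \<tau> x \<ge> 0"
  shows "u x powr q \<le> u (reflect a \<tau> x) powr q"
  using assms u_pos[of x] q by (intro powr_mono2) (auto simp: gap_def cap_def)

text \<open>Signs need to be checked only away from arc and chord; the collar \<open>D\<close>
  follows from the barrier. A negative gap of v pushes the gap of u down by at most a small multiple
  of its size, and conversely, so the two worst negative parts control each other with a contraction
  factor. The width \<open>\<delta>\<close> is independent of \<open>\<tau>\<close>, which the
  continuity argument relies on.\<close>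

lemma ordered_of_core:
  obtains \<delta> where "0 < \<delta>" "\<delta> < 1"
    "\<And>\<tau>. 0 \<le> \<tau> \<Longrightarrow> \<tau> < 1 \<Longrightarrow>
      (\<And>x. x \<in> cap a \<tau> \<Longrightarrow> (norm x)\<^sup>2 \<le> 1 - \<delta> \<Longrightarrow> x \<bullet> a \<ge> \<tau> + \<delta> \<Longrightarrow> gap u \<tau> x \<ge> 0 \<and> gap v \<tau> x \<ge> 0)
      \<Longrightarrow> ordered \<tau>"
proof -
  obtain M where M: "\<And>x. x \<in> cball 0 1 \<Longrightarrow> u x \<le> M"
  proof -
    have "(cball 0 1 :: (real^2) set) \<noteq> {}" by simp
    from continuous_attains_sup[OF compact_cball this cont_u] show ?thesis using that by blast
  qed
  define L where "L = q * M powr (q - 1)"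
  have L: "L \<ge> 0" using q by (simp add: L_def)
  \<comment> \<open>Makes both \<open>\<epsilon>\<close> and \<open>L * \<epsilon>\<close> smaller
    than 1, so that composing the two one-sided estimates is a contraction.\<close>
  define \<epsilon> where "\<epsilon> = 1 / (2 + L)"
  have e: "\<epsilon> > 0" "\<epsilon> < 1" "L * \<epsilon> < 1" using L by (auto simp: \<epsilon>_def field_simps)
  obtain \<delta> where d: "0 < \<delta>" "\<delta> < 1" and
    barrier: "\<And>\<tau>. 0 \<le> \<tau> \<Longrightarrow> \<tau> < 1 \<Longrightarrow> \<exists>\<psi>. continuous_on UNIV \<psi> \<and> (\<forall>x\<in>closed_cap a \<tau>. 0 \<le> \<psi> x \<and> \<psi> x \<le> \<epsilon>) \<and>
       (\<forall>x\<in>cap a \<tau>. (norm x)\<^sup>2 > 1 - \<delta> \<or> x \<bullet> a < \<tau> + \<delta> \<longrightarrow> (\<exists>k\<ge>1. lap_at \<psi> x (- k)))"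
    using thin_barrier[OF e(1) norm_a] by metis
  show thesis
  proof
    fix \<tau> :: real
    assume \<tau>: "0 \<le> \<tau>" "\<tau> < 1"
      and core: "\<And>x. x \<in> cap a \<tau> \<Longrightarrow> (norm x)\<^sup>2 \<le> 1 - \<delta> \<Longrightarrow> x \<bullet> a \<ge> \<tau> + \<delta> \<Longrightarrow> gap u \<tau> x \<ge> 0 \<and> gap v \<tau> x \<ge> 0"
    let ?K = "closed_cap a \<tau>"
    define D where "D = {x \<in> cap a \<tau>. (norm x)\<^sup>2 > 1 - \<delta> \<or> x \<bullet> a < \<tau> + \<delta>}"
    obtain \<psi> where psi: "continuous_on UNIV \<psi>" "\<And>x. x \<in> ?K \<Longrightarrow> 0 \<le> \<psi> x" "\<And>x. x \<in> ?K \<Longrightarrow> \<psi> x \<le> \<epsilon>"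
      "\<And>x. x \<in> D \<Longrightarrow> \<exists>k\<ge>1. lap_at \<psi> x (- k)"
      using barrier[OF \<tau>] unfolding D_def by blast
    have DK: "D \<subseteq> ?K" using cap_subset_closed_cap by (auto simp: D_def)
    have openD: "open D"
    proof -
      have "D = cap a \<tau> \<inter> ({x. 1 - \<delta> < (norm x)\<^sup>2} \<union> {x. x \<bullet> a < \<tau> + \<delta>})" by (auto simp: D_def)
      then show ?thesis
        by (auto intro!: open_Int open_Un open_cap open_Collect_less continuous_intros)
    qed
    have boundedD: "bounded D"
      using DK compact_closed_cap by (meson bounded_subset compact_imp_bounded)
    have closD: "closure D \<subseteq> ?K"
      using DK compact_closed_cap by (intro closure_minimal compact_imp_closed)
    have outside: "gap u \<tau> x \<ge> 0" "gap v \<tau> x \<ge> 0" if "x \<in> ?K - D" for x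
    proof -
      have "gap u \<tau> x \<ge> 0 \<and> gap v \<tau> x \<ge> 0"
      proof (cases "x \<in> cap a \<tau>")
        case True
        then show ?thesis using that core[of x] by (force simp: D_def)
      next
        case False
        then show ?thesis using that gap_boundary_nonneg[OF \<tau>(1), of x] by blast
      qed
      then show "gap u \<tau> x \<ge> 0" "gap v \<tau> x \<ge> 0" by blast+
    qed
    \<comment> \<open>As \<open>D\<close> is open, its frontier points lie on the boundary of the
      cap or in the core, where both signs are known.\<close>
    have frontierD: "frontier D \<subseteq> ?K - D"
      using closD openD by (auto simp: frontier_def interior_open)
    have cont_gu: "continuous_on ?K (gap u \<tau>)" and cont_gv: "continuous_on ?K (gap v \<tau>)"
      using continuous_gap \<tau> cont_u cont_v by auto
    have "a \<in> ?K" using norm_a a_a \<tau> by (simp add: closed_cap_def)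
    then have ne: "?K \<noteq> {}" by blast
    obtain xA where xA: "xA \<in> ?K" "\<And>x. x \<in> ?K \<Longrightarrow> max 0 (- gap u \<tau> x) \<le> max 0 (- gap u \<tau> xA)"
      using continuous_attains_sup[OF compact_closed_cap ne
        continuous_on_max[OF continuous_on_const[of _ 0] continuous_on_minus[OF cont_gu]]] by blast
    obtain xB where xB: "xB \<in> ?K" "\<And>x. x \<in> ?K \<Longrightarrow> max 0 (- gap v \<tau> x) \<le> max 0 (- gap v \<tau> xB)"
      using continuous_attains_sup[OF compact_closed_cap ne
        continuous_on_max[OF continuous_on_const[of _ 0] continuous_on_minus[OF cont_gv]]] by blast
    define A where "A = max 0 (- gap u \<tau> xA)"
    define B where "B = max 0 (- gap v \<tau> xB)"
    have A: "A \<ge> 0" "\<And>x. x \<in> ?K \<Longrightarrow> gap u \<tau> x \<ge> - A"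
      using xA(2) by (force simp: A_def)+
    have B: "B \<ge> 0" "\<And>x. x \<in> ?K \<Longrightarrow> gap v \<tau> x \<ge> - B"
      using xB(2) by (force simp: B_def)+
    \<comment> \<open>The barrier gives \<open>A \<le> \<epsilon>B\<close> and \<open>B \<le> L\<epsilon>A\<close>, which forces \<open>A = B = 0\<close>.\<close>
    have "A \<le> B * \<epsilon>"
    proof (cases "xA \<in> D")
      case True
      have "gap u \<tau> xA + B * \<psi> xA \<ge> 0"
      proof (rule weak_minimum_principle[where f="\<lambda>x. gap u \<tau> x + B * \<psi> x", OF openD boundedD])
        show "continuous_on (closure D) (\<lambda>x. gap u \<tau> x + B * \<psi> x)"
          by (intro continuous_intros continuous_on_subset[OF cont_gu closD] continuous_on_subset[OF psi(1)]) auto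
        show "xA \<in> closure D" using True closure_subset by auto
        show "0 \<le> gap u \<tau> x + B * \<psi> x" if "x \<in> frontier D" for x
          using that frontierD outside(1)[of x] psi(2)[of x] B(1) by auto
        fix x assume x: "x \<in> D"
        then have xK: "x \<in> ?K" "x \<in> cap a \<tau>" using DK by (auto simp: D_def)
        obtain k where k: "k \<ge> 1" "lap_at \<psi> x (- k)" using psi(4)[OF x] by blast
        have "lap_at (\<lambda>x. gap u \<tau> x + B * \<psi> x) x (- gap v \<tau> x + B * (- k))"
          by (intro lap_at_add lap_at_cmult lap_gap_u k \<tau> xK)
        moreover have "- gap v \<tau> x + B * (- k) \<le> 0"
          using B(2)[OF xK(1)] mult_left_mono[OF k(1) B(1)] by simp
        ultimately show "\<exists>l\<le>0. lap_at (\<lambda>x. gap u \<tau> x + B * \<psi> x) x l" by blast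
      qed
      moreover have "B * \<psi> xA \<le> B * \<epsilon>" using B(1) psi(3)[OF xA(1)] by (intro mult_left_mono)
      ultimately show ?thesis using B(1) e(1) by (simp add: A_def)
    next
      case False
      then show ?thesis using outside(1)[of xA] xA(1) B(1) e(1) by (simp add: A_def)
    qed
    moreover have "B \<le> L * A * \<epsilon>"
    proof (cases "xB \<in> D")
      case True
      have LA: "L * A \<ge> 0" using L A by simp
      have "gap v \<tau> xB + L * A * \<psi> xB \<ge> 0"
      proof (rule weak_minimum_principle[where f="\<lambda>x. gap v \<tau> x + L * A * \<psi> x", OF openD boundedD])
        show "continuous_on (closure D) (\<lambda>x. gap v \<tau> x + L * A * \<psi> x)"
          by (intro continuous_intros continuous_on_subset[OF cont_gv closD] continuous_on_subset[OF psi(1)]) auto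
        show "xB \<in> closure D" using True closure_subset by auto
        show "0 \<le> gap v \<tau> x + L * A * \<psi> x" if "x \<in> frontier D" for x
          using that frontierD outside(2)[of x] psi(2)[of x] LA by auto
        fix x assume x: "x \<in> D"
        then have xK: "x \<in> ?K" "x \<in> cap a \<tau>" using DK by (auto simp: D_def)
        obtain k where k: "k \<ge> 1" "lap_at \<psi> x (- k)" using psi(4)[OF x] by blast
        have "lap_at (\<lambda>x. gap v \<tau> x + L * A * \<psi> x) x (- (u (reflect a \<tau> x) powr q - u x powr q) + L * A * (- k))"
          by (intro lap_at_add lap_at_cmult lap_gap_v k \<tau> xK)
        moreover have "- (u (reflect a \<tau> x) powr q - u x powr q) \<le> L * A"
        proof (cases "gap u \<tau> x \<ge> 0")
          case True
          then show ?thesis using u_powr_mono[OF \<tau>(1) xK(2)] LA by simp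
        next
          case False
          have "u x powr q - u (reflect a \<tau> x) powr q \<le> L * (u x - u (reflect a \<tau> x))"
            unfolding L_def
            using False u_pos[OF reflect_cap[OF \<tau>(1) xK(2)]] M[of x] q xK(2)
            by (intro powr_diff_le) (auto simp: gap_def cap_def)
          also have "\<dots> \<le> L * A"
            using A(2)[OF xK(1)] L by (intro mult_left_mono) (auto simp: gap_def)
          finally show ?thesis by simp
        qed
        moreover have "L * A \<le> L * A * k" using mult_left_mono[OF k(1) LA] by simp
        ultimately show "\<exists>l\<le>0. lap_at (\<lambda>x. gap v \<tau> x + L * A * \<psi> x) x l"
          by (intro exI[of _ "- (u (reflect a \<tau> x) powr q - u x powr q) + L * A * (- k)"] conjI) simp_all
      qed
      moreover have "L * A * \<psi> xB \<le> L * A * \<epsilon>" using LA psi(3)[OF xB(1)] by (intro mult_left_mono)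
      ultimately show ?thesis using LA e(1) by (simp add: B_def)
    next
      case False
      then show ?thesis using outside(2)[of xB] xB(1) L A(1) e(1) by (simp add: B_def)
    qed
    ultimately have AB: "A \<le> B * \<epsilon>" "B \<le> L * A * \<epsilon>" by auto
    note AB(1)
    also have "B * \<epsilon> \<le> (L * A * \<epsilon>) * \<epsilon>"
      using AB(2) e(1) by (intro mult_right_mono) auto
    also have "\<dots> = (L * \<epsilon>) * \<epsilon> * A" by (simp add: mult_ac)
    also have "\<dots> \<le> \<epsilon> * A"
    proof -
      have "(L * \<epsilon>) * \<epsilon> \<le> 1 * \<epsilon>" using e by (intro mult_right_mono) auto
      then show ?thesis using A(1) by (intro mult_right_mono) auto
    qed
    finally have "(1 - \<epsilon>) * A \<le> 0" by (simp add: algebra_simps)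
    then have "A = 0" using A(1) e(2) by (simp add: mult_le_0_iff)
    then have "B = 0" using AB(2) B(1) by simp
    show "ordered \<tau>"
      unfolding ordered_def using A(2) B(2) \<open>A = 0\<close> \<open>B = 0\<close> cap_subset_closed_cap[of a \<tau>] by force
  qed (use d in auto)
qed

text \<open>Shifting the line by t moves the reflected point by 2t, hence the halved modulus of
  uniform continuity. The estimate is uniform over the common part of the two caps.\<close>

lemma gap_uniformly_close:
  assumes f: "continuous_on (cball 0 1) f" and "\<eta> > 0"
  obtains d where "d > 0"
    "\<And>\<sigma> \<tau> x. 0 \<le> \<sigma> \<Longrightarrow> 0 \<le> \<tau> \<Longrightarrow> \<bar>\<tau> - \<sigma>\<bar> < d \<Longrightarrow> x \<in> closed_cap a \<sigma> \<Longrightarrow> x \<in> closed_cap a \<tau> \<Longrightarrow> \<bar>gap f \<tau> x - gap f \<sigma> x\<bar> < \<eta>"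
proof -
  have "uniformly_continuous_on (cball 0 1) f"
    by (rule compact_uniformly_continuous[OF f compact_cball])
  then obtain d where d: "d > 0"
    "\<And>x x'. x \<in> cball 0 1 \<Longrightarrow> x' \<in> cball 0 1 \<Longrightarrow> dist x' x < d \<Longrightarrow> dist (f x') (f x) < \<eta>"
    using assms(2) unfolding uniformly_continuous_on_def by metis
  show thesis
  proof (rule that[of "d / 2"])
    fix \<sigma> \<tau> x assume *: "0 \<le> \<sigma>" "0 \<le> \<tau>" "\<bar>\<tau> - \<sigma>\<bar> < d / 2" "x \<in> closed_cap a \<sigma>" "x \<in> closed_cap a \<tau>"
    have "dist (f (reflect a \<tau> x)) (f (reflect a \<sigma> x)) < \<eta>"
      using * by (intro d(2) reflect_closed_cap) (auto simp: dist_reflect norm_a)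
    then show "\<bar>gap f \<tau> x - gap f \<sigma> x\<bar> < \<eta>" by (simp add: gap_def dist_real_def)
  qed (use d in auto)
qed

text \<open>A point of the open cap at \<open>s\<close> also belongs to the caps at slightly larger
  \<open>\<mu>\<close>, and the gap is continuous in the position of the line. This is used at the
  last bad position and again to reach the line through the centre.\<close>

lemma ordered_limit:
  assumes s: "0 \<le> s" "s < 1" and ord: "\<And>\<mu>. s < \<mu> \<Longrightarrow> \<mu> < 1 \<Longrightarrow> ordered \<mu>"
  shows "ordered s"
proof -
  have *: "gap f s x \<ge> 0"
    if f: "continuous_on (cball 0 1) f" and x: "x \<in> cap a s"
      and nn: "\<And>\<mu>. s < \<mu> \<Longrightarrow> \<mu> < 1 \<Longrightarrow> x \<in> cap a \<mu> \<Longrightarrow> gap f \<mu> x \<ge> 0" for f x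
  proof (rule ccontr)
    assume neg: "\<not> gap f s x \<ge> 0"
    then have "- gap f s x > 0" by simp
    from gap_uniformly_close[OF f this] obtain d where d: "d > 0"
      "\<And>\<sigma> \<tau> y. 0 \<le> \<sigma> \<Longrightarrow> 0 \<le> \<tau> \<Longrightarrow> \<bar>\<tau> - \<sigma>\<bar> < d \<Longrightarrow> y \<in> closed_cap a \<sigma> \<Longrightarrow> y \<in> closed_cap a \<tau> \<Longrightarrow> \<bar>gap f \<tau> y - gap f \<sigma> y\<bar> < - gap f s x"
      by metis
    have "s < min (s + d) (min (x \<bullet> a) 1)" using d x s by (auto simp: cap_def)
    then obtain \<mu> where mu: "s < \<mu>" "\<mu> < min (s + d) (min (x \<bullet> a) 1)" using dense by blast
    then have "x \<in> cap a \<mu>" using x by (auto simp: cap_def)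
    moreover have "\<bar>gap f \<mu> x - gap f s x\<bar> < - gap f s x"
      using mu s x \<open>x \<in> cap a \<mu>\<close> cap_subset_closed_cap by (intro d(2)) auto
    ultimately show False using nn[of \<mu>] mu by auto
  qed
  show ?thesis
    unfolding ordered_def
    by (intro ballI conjI *[OF cont_u] *[OF cont_v]) (use ord in \<open>auto simp: ordered_def\<close>)
qed

text \<open>At the pole \<open>a\<close> the solution vanishes, whereas the reflected pole (2
  \<open>s\<close> - 1) \<open>a\<close> is interior exactly because 0 < \<open>s\<close> < 1. So
  the gap is positive near the pole, and the strong minimum principle spreads this over the
  cap.\<close>

lemma gap_pos:
  assumes s: "0 < s" "s < 1" and ord: "ordered s" and x: "x \<in> cap a s"
  shows "gap u s x > 0" "gap v s x > 0"
proof -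
  have s0: "0 \<le> s" using s by simp
  have *: "gap f s y > 0"
    if f: "continuous_on (cball 0 1) f" and f0: "\<And>x. norm x = 1 \<Longrightarrow> f x = 0"
      and fpos: "\<And>x. x \<in> ball 0 1 \<Longrightarrow> f x > 0"
      and nn: "\<And>x. x \<in> cap a s \<Longrightarrow> gap f s x \<ge> 0"
      and lap: "\<And>x. x \<in> cap a s \<Longrightarrow> \<exists>l\<le>0. lap_at (gap f s) x l"
      and y: "y \<in> cap a s" for f y
  proof -
    have refl: "reflect a s a = (2 * s - 1) *\<^sub>R a"
    proof -
      have "reflect a s a = (1 + 2 * (s - 1)) *\<^sub>R a"
        unfolding reflect_def a_a by (simp only: scaleR_left_distrib scaleR_one)
      then show ?thesis by (simp add: algebra_simps)
    qed
    have "\<bar>2 * s - 1\<bar> < 1" using s by linarith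
    then have "reflect a s a \<in> ball 0 1" using norm_a by (simp add: refl)
    then have pos: "gap f s a > 0" using fpos f0[OF norm_a] by (simp add: gap_def)
    have aK: "a \<in> closed_cap a s" using norm_a a_a s by (simp add: closed_cap_def)
    obtain d where d: "d > 0" "\<And>x. x \<in> closed_cap a s \<Longrightarrow> dist x a < d \<Longrightarrow> dist (gap f s x) (gap f s a) < gap f s a"
      using continuous_gap[OF f s0] pos aK unfolding continuous_on_iff by metis
    define t where "t = min d (1 - s) / 2"
    have t: "0 < t" "t < d" "t < 1 - s" using d s by (auto simp: t_def min_def field_simps)
    have yc: "(1 - t) *\<^sub>R a \<in> cap a s" using t s norm_a a_a by (auto simp: cap_def)
    have "dist ((1 - t) *\<^sub>R a) a < d"
    proof -
      have "(1 - t) *\<^sub>R a - a = (- t) *\<^sub>R a" by (simp add: algebra_simps)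
      then show ?thesis using t norm_a by (simp add: dist_norm)
    qed
    then have "gap f s ((1 - t) *\<^sub>R a) > 0"
      using d(2)[of "(1 - t) *\<^sub>R a"] yc cap_subset_closed_cap[of a s] by (auto simp: dist_real_def)
    then show ?thesis
      using strong_minimum_principle[OF open_cap convex_connected[OF convex_cap]
          continuous_on_subset[OF continuous_gap[OF f s0] cap_subset_closed_cap] lap nn yc _ y] by blast
  qed
  show "gap u s x > 0"
  proof (rule *[OF cont_u u_0 u_pos _ _ x])
    fix y assume y: "y \<in> cap a s"
    show "gap u s y \<ge> 0" using ord y by (simp add: ordered_def)
    have "- gap v s y \<le> 0" using ord y by (simp add: ordered_def)
    then show "\<exists>l\<le>0. lap_at (gap u s) y l" using lap_gap_u[OF s0 y] by blast
  qed auto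
  show "gap v s x > 0"
  proof (rule *[OF cont_v v_0 v_pos _ _ x])
    fix y assume y: "y \<in> cap a s"
    show "gap v s y \<ge> 0" using ord y by (simp add: ordered_def)
    have "- (u (reflect a s y) powr q - u y powr q) \<le> 0"
      using ord y u_powr_mono[OF s0 y] by (simp add: ordered_def)
    then show "\<exists>l\<le>0. lap_at (gap v s) y l" using lap_gap_v[OF s0 y] by blast
  qed auto
qed

text \<open>Let \<open>s\<close> be the supremum of the bad positions. It is below 1, because caps
  close to the pole have an empty core, and it is itself good by passage to the limit. Strict
  positivity on a compact set then persists for lines slightly below \<open>s\<close>, so these are
  good as well, contradicting the choice of \<open>s\<close>.\<close>

lemma ordered_pos:
  assumes "0 < \<tau>" "\<tau> < 1"
  shows "ordered \<tau>"
proof (rule ccontr)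
  assume not: "\<not> ordered \<tau>"
  obtain \<delta> where d: "0 < \<delta>" "\<delta> < 1" and
    core: "\<And>\<tau>. 0 \<le> \<tau> \<Longrightarrow> \<tau> < 1 \<Longrightarrow>
      (\<And>x. x \<in> cap a \<tau> \<Longrightarrow> (norm x)\<^sup>2 \<le> 1 - \<delta> \<Longrightarrow> x \<bullet> a \<ge> \<tau> + \<delta> \<Longrightarrow> gap u \<tau> x \<ge> 0 \<and> gap v \<tau> x \<ge> 0)
      \<Longrightarrow> ordered \<tau>"
    using ordered_of_core by metis
  define S where "S = {\<tau>. 0 < \<tau> \<and> \<tau> < 1 \<and> \<not> ordered \<tau>}"
  define s where "s = Sup S"
  have tS: "\<tau> \<in> S" using assms not by (simp add: S_def)
  have S_le: "\<sigma> \<le> 1 - \<delta>" if "\<sigma> \<in> S" for \<sigma>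
  proof (rule ccontr)
    assume gt: "\<not> \<sigma> \<le> 1 - \<delta>"
    have "ordered \<sigma>"
    proof (rule core)
      fix x assume x: "x \<in> cap a \<sigma>" "x \<bullet> a \<ge> \<sigma> + \<delta>"
      have "x \<bullet> a \<le> 1" using inner_le_one[OF norm_a, of x] x by (simp add: cap_def)
      then show "gap u \<sigma> x \<ge> 0 \<and> gap v \<sigma> x \<ge> 0" using x gt by linarith
    qed (use that in \<open>auto simp: S_def\<close>)
    then show False using that by (simp add: S_def)
  qed
  have bdd: "bdd_above S" using S_le by (auto simp: bdd_above_def)
  have s_le: "s \<le> 1 - \<delta>" unfolding s_def using tS S_le by (intro cSup_least) auto
  have s: "0 < s" "s < 1"
    using cSup_upper[OF tS bdd] assms s_le d by (auto simp: s_def)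
  have ord: "ordered s"
  proof (rule ordered_limit)
    fix \<mu> assume mu: "s < \<mu>" "\<mu> < 1"
    show "ordered \<mu>"
    proof (rule ccontr)
      assume "\<not> ordered \<mu>"
      then have "\<mu> \<in> S" using mu s by (simp add: S_def)
      then show False using cSup_upper[OF _ bdd, of \<mu>] mu by (simp add: s_def)
    qed
  qed (use s in auto)
  \<comment> \<open>Half of the margin \<open>\<delta>\<close> is given away: as long as the line
    moves back by less than \<open>\<delta> / 2\<close>, the core of the moved cap still lies in
    this fixed compact set.\<close>
  define K where "K = {x \<in> cball 0 1. (norm x)\<^sup>2 \<le> 1 - \<delta> \<and> s + \<delta> / 2 \<le> x \<bullet> a}"
  have cptK: "compact K"
  proof -
    have "K = cball 0 1 \<inter> ({x. (norm x)\<^sup>2 \<le> 1 - \<delta>} \<inter> {x. s + \<delta> / 2 \<le> x \<bullet> a})" by (auto simp: K_def)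
    then show ?thesis
      by (auto intro!: compact_Int_closed closed_Int closed_Collect_le continuous_intros)
  qed
  have Kcap: "K \<subseteq> cap a s"
  proof
    fix x assume x: "x \<in> K"
    then have "(norm x)\<^sup>2 < 1\<^sup>2" using d by (simp add: K_def)
    then have "norm x < 1" by (rule power_less_imp_less_base) simp
    then show "x \<in> cap a s" using x d by (simp add: K_def cap_def)
  qed
  have ex: "\<exists>\<eta>>0. \<forall>x\<in>K. gap f s x \<ge> \<eta>"
    if "continuous_on (cball 0 1) f" "\<And>x. x \<in> cap a s \<Longrightarrow> gap f s x > 0" for f
  proof (cases "K = {}")
    case True
    then show ?thesis by (intro exI[of _ 1]) auto
  next
    case False
    have "continuous_on K (gap f s)"
      using Kcap cap_subset_closed_cap s by (intro continuous_on_subset[OF continuous_gap[OF that(1)]]) auto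
    from continuous_attains_inf[OF cptK False this] show ?thesis using that(2) Kcap by blast
  qed
  obtain \<eta>u where eu: "\<eta>u > 0" "\<And>x. x \<in> K \<Longrightarrow> gap u s x \<ge> \<eta>u"
    using ex[OF cont_u] gap_pos(1)[OF s ord] by blast
  obtain \<eta>v where ev: "\<eta>v > 0" "\<And>x. x \<in> K \<Longrightarrow> gap v s x \<ge> \<eta>v"
    using ex[OF cont_v] gap_pos(2)[OF s ord] by blast
  obtain du where du: "du > 0"
    "\<And>\<sigma> \<tau> x. 0 \<le> \<sigma> \<Longrightarrow> 0 \<le> \<tau> \<Longrightarrow> \<bar>\<tau> - \<sigma>\<bar> < du \<Longrightarrow> x \<in> closed_cap a \<sigma> \<Longrightarrow> x \<in> closed_cap a \<tau> \<Longrightarrow> \<bar>gap u \<tau> x - gap u \<sigma> x\<bar> < \<eta>u"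
    using gap_uniformly_close[OF cont_u eu(1)] by metis
  obtain dv where dv: "dv > 0"
    "\<And>\<sigma> \<tau> x. 0 \<le> \<sigma> \<Longrightarrow> 0 \<le> \<tau> \<Longrightarrow> \<bar>\<tau> - \<sigma>\<bar> < dv \<Longrightarrow> x \<in> closed_cap a \<sigma> \<Longrightarrow> x \<in> closed_cap a \<tau> \<Longrightarrow> \<bar>gap v \<tau> x - gap v \<sigma> x\<bar> < \<eta>v"
    using gap_uniformly_close[OF cont_v ev(1)] by metis
  define d0 where "d0 = min (\<delta> / 2) (min du dv)"
  have "s - d0 < s" using d du dv by (simp add: d0_def)
  then obtain \<sigma> where sig: "\<sigma> \<in> S" "s - d0 < \<sigma>"
    using less_cSup_iff[of S "s - d0"] tS bdd by (auto simp: s_def)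
  have sig_le: "\<sigma> \<le> s" using cSup_upper[OF sig(1) bdd] by (simp add: s_def)
  have sig01: "0 \<le> \<sigma>" "\<sigma> < 1" using sig(1) by (auto simp: S_def)
  have "ordered \<sigma>"
  proof (rule core[OF sig01])
    fix x assume x: "x \<in> cap a \<sigma>" "(norm x)\<^sup>2 \<le> 1 - \<delta>" "x \<bullet> a \<ge> \<sigma> + \<delta>"
    have xK: "x \<in> K" using x sig by (auto simp: K_def cap_def d0_def)
    have cl: "x \<in> closed_cap a s" "x \<in> closed_cap a \<sigma>"
      using xK Kcap x(1) cap_subset_closed_cap by blast+
    have "\<bar>gap u \<sigma> x - gap u s x\<bar> < \<eta>u" "\<bar>gap v \<sigma> x - gap v s x\<bar> < \<eta>v"
      using sig sig_le sig01 s cl by (auto intro!: du(2) dv(2) simp: d0_def)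
    then show "gap u \<sigma> x \<ge> 0 \<and> gap v \<sigma> x \<ge> 0"
      using eu(2)[OF xK] ev(2)[OF xK] by auto
  qed
  then show False using sig(1) by (simp add: S_def)
qed

lemma ordered_0: "ordered 0"
  by (rule ordered_limit) (auto intro: ordered_pos)

end

section \<open>Radial symmetry\<close>

context disk_solution
begin

text \<open>Points of equal norm are mirror images across the line through the centre orthogonal to
  \<open>x - y\<close>, with \<open>x\<close> on the cap side. Exchanging the two points later gives
  equality.\<close>

lemma radial_le:
  assumes "norm x = norm y" "norm x < 1"
  shows "u x \<le> u y \<and> v x \<le> v y"
proof (cases "x = y")
  case False
  define a where "a = (1 / norm (x - y)) *\<^sub>R (x - y)"
  have n: "norm (x - y) > 0" using False by simp
  interpret moving_plane q u v a
    by unfold_locales (use n in \<open>simp add: a_def\<close>)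
  have sq: "x \<bullet> x = y \<bullet> y" using assms(1) by (simp add: norm_eq)
  have nn: "(norm (x - y))\<^sup>2 = 2 * (x \<bullet> (x - y))"
    unfolding power2_norm_eq_inner using sq by (simp add: inner_simps inner_commute)
  have xa: "x \<bullet> a = norm (x - y) / 2"
  proof -
    have "x \<bullet> a = (x \<bullet> (x - y)) / norm (x - y)" by (simp add: a_def)
    also have "\<dots> = norm (x - y) / 2"
      using n nn by (simp add: field_simps power2_eq_square)
    finally show ?thesis .
  qed
  have "reflect a 0 x = y"
    unfolding reflect_def xa using n by (simp add: a_def)
  moreover have "x \<bullet> a > 0" using xa n by linarith
  then have "x \<in> cap a 0" using assms(2) by (simp add: cap_def)
  ultimately show ?thesis using ordered_0 unfolding ordered_def gap_def by force
qed auto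

lemma radial:
  assumes "norm x = norm y" "norm x < 1"
  shows "u x = u y" "v x = v y"
  using radial_le[of x y] radial_le[of y x] assms by auto

end

section \<open>Radial profiles\<close>

text \<open>Bernoulli's inequality with real exponent: the difference of the two sides has
  derivative \<open>q\<close> ((1 + t)^(\<open>q\<close> - 1) - 1) >= 0.\<close>

lemma one_plus_mult_le_powr:
  fixes q y :: real
  assumes "q \<ge> 1" "y \<ge> 0"
  shows "1 + q * y \<le> (1 + y) powr q"
proof -
  have "(1 + 0) powr q - q * 0 \<le> (1 + y) powr q - q * y"
  proof (rule DERIV_nonneg_imp_increasing_open[where f="\<lambda>t. (1 + t) powr q - q * t", OF assms(2)])
    fix x assume x: "0 < x" "x < y"
    have "((\<lambda>t. (1 + t) powr q - q * t) has_real_derivative q * (1 + x) powr (q - 1) - q) (at x)"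
      using x by (auto intro!: derivative_eq_intros)
    moreover have "(1 + x) powr (q - 1) \<ge> 1"
      using x assms by (intro ge_one_powr_ge_zero) auto
    ultimately show "\<exists>d. ((\<lambda>t. (1 + t) powr q - q * t) has_real_derivative d) (at x) \<and> 0 \<le> d"
      using assms by force
  qed (use assms in \<open>auto intro!: continuous_intros\<close>)
  then show ?thesis by simp
qed

text \<open>At radius 1/2 one has \<open>U\<close>^q <= 8 m <= 16 V <= 256 \<open>U\<close>, so
  \<open>U\<close> <= 256^(1/\<open>\<kappa>\<close>) and m <= 32 \<open>U\<close>. The mass over
  the whole disk is at most four times the mass inside radius 1/2, which gives 4 * 32 = 128.\<close>

definition total_mass_bound :: "real \<Rightarrow> real" where
  "total_mass_bound \<kappa> = 128 * 256 powr (1 / \<kappa>)"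

lemma total_mass_bound_ge: "\<kappa> > 0 \<Longrightarrow> total_mass_bound \<kappa> \<ge> 128"
  using ge_one_powr_ge_zero[of 256 "1 / \<kappa>"] by (simp add: total_mass_bound_def)

text \<open>Here \<open>m r = - r * V' r\<close> and \<open>n r = - r * U' r\<close>, so that \<open>m\<close> is the mass of \<open>U powr q\<close> in the
  disk of radius \<open>r\<close> (up to \<open>2\<pi>\<close>) and \<open>n\<close> that of \<open>V\<close>.\<close>

locale radial_profile =
  fixes q \<kappa> :: real and U V m n :: "real \<Rightarrow> real"
  assumes kappa: "\<kappa> > 0" and q: "q \<ge> 1 + \<kappa>"
    and contU: "continuous_on {0..1} U" and contV: "continuous_on {0..1} V"
    and contm: "continuous_on {0..<1} m" and contn: "continuous_on {0..<1} n"
    and U_pos: "\<And>r. 0 \<le> r \<Longrightarrow> r < 1 \<Longrightarrow> U r > 0" and U_1: "U 1 = 0"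
    and V_pos: "\<And>r. 0 \<le> r \<Longrightarrow> r < 1 \<Longrightarrow> V r > 0" and V_1: "V 1 = 0"
    and m_0: "m 0 = 0" and n_0: "n 0 = 0"
    and DU: "\<And>r. 0 < r \<Longrightarrow> r < 1 \<Longrightarrow> (U has_real_derivative - (n r / r)) (at r)"
    and DV: "\<And>r. 0 < r \<Longrightarrow> r < 1 \<Longrightarrow> (V has_real_derivative - (m r / r)) (at r)"
    and Dn: "\<And>r. 0 < r \<Longrightarrow> r < 1 \<Longrightarrow> (n has_real_derivative r * V r) (at r)"
    and Dm: "\<And>r. 0 < r \<Longrightarrow> r < 1 \<Longrightarrow> (m has_real_derivative r * U r powr q) (at r)"
begin

lemma q_gt_1: "q > 1"
  using kappa q by linarith

lemma contU': "0 \<le> a \<Longrightarrow> b \<le> 1 \<Longrightarrow> continuous_on {a..b} U"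
  by (rule continuous_on_subset[OF contU]) auto

lemma contV': "0 \<le> a \<Longrightarrow> b \<le> 1 \<Longrightarrow> continuous_on {a..b} V"
  by (rule continuous_on_subset[OF contV]) auto

lemma contm': "0 \<le> a \<Longrightarrow> b < 1 \<Longrightarrow> continuous_on {a..b} m"
  by (rule continuous_on_subset[OF contm]) auto

lemma contn': "0 \<le> a \<Longrightarrow> b < 1 \<Longrightarrow> continuous_on {a..b} n"
  by (rule continuous_on_subset[OF contn]) auto

lemma m_mono: "0 \<le> a \<Longrightarrow> a \<le> b \<Longrightarrow> b < 1 \<Longrightarrow> m a \<le> m b"
proof (rule DERIV_nonneg_imp_increasing_open[OF _ _ contm'])
  fix x assume "0 \<le> a" "a < x" "x < b" "b < 1"
  then show "\<exists>y. (m has_real_derivative y) (at x) \<and> 0 \<le> y"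
    by (intro exI[of _ "x * U x powr q"] conjI Dm) auto
qed auto

lemma n_mono: "0 \<le> a \<Longrightarrow> a \<le> b \<Longrightarrow> b < 1 \<Longrightarrow> n a \<le> n b"
proof (rule DERIV_nonneg_imp_increasing_open[OF _ _ contn'])
  fix x assume "0 \<le> a" "a < x" "x < b" "b < 1"
  then show "\<exists>y. (n has_real_derivative y) (at x) \<and> 0 \<le> y"
    using V_pos[of x] by (intro exI[of _ "x * V x"] conjI Dn) auto
qed auto

lemma m_nonneg: "0 \<le> r \<Longrightarrow> r < 1 \<Longrightarrow> 0 \<le> m r"
  using m_mono[of 0 r] m_0 by simp

lemma n_nonneg: "0 \<le> r \<Longrightarrow> r < 1 \<Longrightarrow> 0 \<le> n r"
  using n_mono[of 0 r] n_0 by simp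

lemma U_antimono: "0 \<le> a \<Longrightarrow> a \<le> b \<Longrightarrow> b \<le> 1 \<Longrightarrow> U b \<le> U a"
proof (rule DERIV_nonpos_imp_decreasing_open[OF _ _ contU'])
  fix x assume "0 \<le> a" "a < x" "x < b" "b \<le> 1"
  then show "\<exists>y. (U has_real_derivative y) (at x) \<and> y \<le> 0"
    using n_nonneg[of x] by (intro exI[of _ "- (n x / x)"] conjI DU) auto
qed auto

lemma V_antimono: "0 \<le> a \<Longrightarrow> a \<le> b \<Longrightarrow> b \<le> 1 \<Longrightarrow> V b \<le> V a"
proof (rule DERIV_nonpos_imp_decreasing_open[OF _ _ contV'])
  fix x assume "0 \<le> a" "a < x" "x < b" "b \<le> 1"
  then show "\<exists>y. (V has_real_derivative y) (at x) \<and> y \<le> 0"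
    using m_nonneg[of x] by (intro exI[of _ "- (m x / x)"] conjI DV) auto
qed auto

lemma Uq_antimono: "0 \<le> a \<Longrightarrow> a \<le> b \<Longrightarrow> b < 1 \<Longrightarrow> U b powr q \<le> U a powr q"
  using U_antimono[of a b] U_pos[of b] q_gt_1 by (intro powr_mono2) auto

text \<open>The factor (b^2 - a^2)/2 is the area of the annulus over 2 pi, and the density
  \<open>U powr q\<close> is smallest at its outer edge.\<close>

lemma m_increment_ge:
  assumes "0 \<le> a" "a \<le> b" "b < 1"
  shows "m b - m a \<ge> (b^2 - a^2) / 2 * U b powr q"
proof -
  have "m a - a^2/2 * U b powr q \<le> m b - b^2/2 * U b powr q"
  proof (rule DERIV_nonneg_imp_increasing_open[where f="\<lambda>r. m r - r^2/2 * U b powr q", OF assms(2)])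
    fix x assume x: "a < x" "x < b"
    have "((\<lambda>r. m r - r^2/2 * U b powr q) has_real_derivative x * U x powr q - x * U b powr q) (at x)"
      using assms x by (auto intro!: derivative_eq_intros Dm)
    moreover have "x * U b powr q \<le> x * U x powr q"
      using assms x by (intro mult_left_mono Uq_antimono) auto
    ultimately show "\<exists>y. ((\<lambda>r. m r - r^2/2 * U b powr q) has_real_derivative y) (at x) \<and> 0 \<le> y"
      by force
  qed (use assms in \<open>auto intro!: continuous_intros contm'\<close>)
  then show ?thesis by (simp add: algebra_simps diff_divide_distrib)
qed

lemma m_increment_le:
  assumes "0 \<le> a" "a \<le> b" "b < 1"
  shows "m b - m a \<le> (b^2 - a^2) / 2 * U a powr q"
proof -
  have "m a - a^2/2 * U a powr q \<ge> m b - b^2/2 * U a powr q"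
  proof (rule DERIV_nonpos_imp_decreasing_open[where f="\<lambda>r. m r - r^2/2 * U a powr q", OF assms(2)])
    fix x assume x: "a < x" "x < b"
    have "((\<lambda>r. m r - r^2/2 * U a powr q) has_real_derivative x * U x powr q - x * U a powr q) (at x)"
      using assms x by (auto intro!: derivative_eq_intros Dm)
    moreover have "x * U a powr q \<ge> x * U x powr q"
      using assms x by (intro mult_left_mono Uq_antimono) auto
    ultimately show "\<exists>y. ((\<lambda>r. m r - r^2/2 * U a powr q) has_real_derivative y) (at x) \<and> y \<le> 0"
      by force
  qed (use assms in \<open>auto intro!: continuous_intros contm'\<close>)
  then show ?thesis by (simp add: algebra_simps diff_divide_distrib)
qed

lemma n_ge:
  assumes "0 \<le> b" "b < 1"
  shows "n b \<ge> b^2 / 2 * V b"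
proof -
  have "n 0 - 0^2/2 * V b \<le> n b - b^2/2 * V b"
  proof (rule DERIV_nonneg_imp_increasing_open[where f="\<lambda>r. n r - r^2/2 * V b", OF assms(1)])
    fix x assume x: "0 < x" "x < b"
    have "((\<lambda>r. n r - r^2/2 * V b) has_real_derivative x * V x - x * V b) (at x)"
      using assms x by (auto intro!: derivative_eq_intros Dn)
    moreover have "x * V b \<le> x * V x"
      using assms x by (intro mult_left_mono V_antimono) auto
    ultimately show "\<exists>y. ((\<lambda>r. n r - r^2/2 * V b) has_real_derivative y) (at x) \<and> 0 \<le> y"
      by force
  qed (use assms in \<open>auto intro!: continuous_intros contn'\<close>)
  then show ?thesis by (simp add: n_0)
qed

text \<open>Beyond \<open>r\<close> the enclosed mass is at least \<open>m r\<close>, so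
  \<open>V\<close> decreases at least as fast as \<open>m r\<close> times the fundamental solution,
  and both vanish at radius 1.\<close>

lemma V_ge_log:
  assumes "0 < r" "r < 1"
  shows "V r \<ge> m r * ln (1 / r)"
proof -
  have "V r + m r * ln r \<ge> V 1 + m r * ln 1"
  proof (rule DERIV_nonpos_imp_decreasing_open[where f="\<lambda>s. V s + m r * ln s"])
    fix x assume x: "r < x" "x < 1"
    have "((\<lambda>s. V s + m r * ln s) has_real_derivative - (m x / x) + m r / x) (at x)"
      using assms x by (auto intro!: derivative_eq_intros DV)
    moreover have "m r / x \<le> m x / x"
      using assms x by (intro divide_right_mono m_mono) auto
    ultimately show "\<exists>y. ((\<lambda>s. V s + m r * ln s) has_real_derivative y) (at x) \<and> y \<le> 0"
      by force
  qed (use assms in \<open>auto intro!: continuous_intros contV'\<close>)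
  then show ?thesis using assms by (simp add: V_1 ln_div)
qed

lemma U_ge_log:
  assumes "0 < r" "r < 1"
  shows "U r \<ge> n r * ln (1 / r)"
proof -
  have "U r + n r * ln r \<ge> U 1 + n r * ln 1"
  proof (rule DERIV_nonpos_imp_decreasing_open[where f="\<lambda>s. U s + n r * ln s"])
    fix x assume x: "r < x" "x < 1"
    have "((\<lambda>s. U s + n r * ln s) has_real_derivative - (n x / x) + n r / x) (at x)"
      using assms x by (auto intro!: derivative_eq_intros DU)
    moreover have "n r / x \<le> n x / x"
      using assms x by (intro divide_right_mono n_mono) auto
    ultimately show "\<exists>y. ((\<lambda>s. U s + n r * ln s) has_real_derivative y) (at x) \<and> y \<le> 0"
      by force
  qed (use assms in \<open>auto intro!: continuous_intros contU'\<close>)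
  then show ?thesis using assms by (simp add: U_1 ln_div)
qed

lemma half_bounds:
  shows "V (1/2) \<ge> m (1/2) / 2" "U (1/2) \<ge> V (1/2) / 16" "m (1/2) \<ge> U (1/2) powr q / 8"
proof -
  have ln2: "ln (2::real) \<ge> 1/2"
    using ln2_ge_two_thirds by linarith
  have "m (1/2) * (1/2) \<le> m (1/2) * ln 2"
    using m_nonneg[of "1/2"] ln2 by (intro mult_left_mono) auto
  then show "V (1/2) \<ge> m (1/2) / 2"
    using V_ge_log[of "1/2"] by simp
  have "n (1/2) * (1/2) \<le> n (1/2) * ln 2"
    using n_nonneg[of "1/2"] ln2 by (intro mult_left_mono) auto
  then show "U (1/2) \<ge> V (1/2) / 16"
    using U_ge_log[of "1/2"] n_ge[of "1/2"] by (simp add: power2_eq_square)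
  show "m (1/2) \<ge> U (1/2) powr q / 8"
    using m_increment_ge[of 0 "1/2"] m_0 by (simp add: power2_eq_square)
qed

section \<open>Upper bounds uniform in q\<close>

abbreviation "K \<equiv> total_mass_bound \<kappa>"

text \<open>The comparisons of \<open>half_bounds\<close> form a cycle, bounding
  \<open>x powr q\<close> by 256 \<open>x\<close>. After division by \<open>x\<close>, the root of
  order \<open>q - 1\<close> is controlled because \<open>q - 1 \<ge> \<kappa>\<close>.\<close>

lemma U_half_le: "U (1/2) \<le> K / 128"
proof -
  define x where "x = U (1/2)"
  have x: "x > 0" unfolding x_def using U_pos[of "1/2"] by simp
  have "x powr q \<le> 256 * x"
    using half_bounds unfolding x_def by linarith
  moreover have "x powr q = x powr (q - 1) * x"
    using x by (simp add: powr_diff)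
  ultimately have le: "x powr (q - 1) \<le> 256" using x by simp
  have "x = (x powr (q - 1)) powr (1 / (q - 1))"
    using x q_gt_1 by (simp add: powr_powr)
  also have "\<dots> \<le> 256 powr (1 / (q - 1))"
    using le q_gt_1 by (intro powr_mono2) auto
  also have "\<dots> \<le> 256 powr (1 / \<kappa>)"
    using q kappa by (intro powr_mono divide_left_mono) auto
  finally show ?thesis by (simp add: x_def total_mass_bound_def)
qed

lemma m_half_le: "m (1/2) \<le> K / 4"
  using half_bounds U_half_le by linarith

lemma m_half_pos: "m (1/2) > 0"
proof -
  have "U (1/2) powr q > 0" using U_pos[of "1/2"] by simp
  then show ?thesis using half_bounds(3) by linarith
qed

text \<open>Outside radius 1/2 the area factor is at most 3/8 and the density at most 8
  \<open>m (1/2)\<close>, so the outer annulus adds at most 3 \<open>m (1/2)\<close>.\<close>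

lemma m_le: assumes "0 \<le> r" "r < 1" shows "m r \<le> 4 * m (1/2)"
proof (cases "r \<le> 1/2")
  case True
  then show ?thesis using m_mono[of r "1/2"] m_half_pos assms by simp
next
  case False
  have "m r - m (1/2) \<le> (r^2 - (1/2)^2) / 2 * U (1/2) powr q"
    using False assms by (intro m_increment_le) auto
  also have "\<dots> \<le> (3/8) * U (1/2) powr q"
    using assms by (intro mult_right_mono) (auto simp: power2_eq_square mult_le_one)
  finally show ?thesis using half_bounds(3) by simp
qed

lemma V_le_log:
  assumes "0 < r" "r < 1"
  shows "V r \<le> 4 * m (1/2) * ln (1 / r)"
proof -
  let ?k = "4 * m (1/2)"
  have "V r + ?k * ln r \<le> V 1 + ?k * ln 1"
  proof (rule DERIV_nonneg_imp_increasing_open[where f="\<lambda>s. V s + ?k * ln s"])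
    fix x assume x: "r < x" "x < 1"
    have "((\<lambda>s. V s + ?k * ln s) has_real_derivative - (m x / x) + ?k / x) (at x)"
      using assms x by (auto intro!: derivative_eq_intros DV)
    moreover have "m x / x \<le> ?k / x"
      using assms x by (intro divide_right_mono m_le) auto
    ultimately show "\<exists>y. ((\<lambda>s. V s + ?k * ln s) has_real_derivative y) (at x) \<and> 0 \<le> y"
      by force
  qed (use assms in \<open>auto intro!: continuous_intros contV'\<close>)
  then show ?thesis using assms by (simp add: V_1 ln_div)
qed

text \<open>The logarithmic bound on \<open>V\<close> is singular at 0, but the weight
  \<open>x\<close> in the derivative of \<open>n\<close> absorbs it through ln(1/x) <= 1/x. The
  result bounds \<open>n r / r\<close>, the slope of \<open>U\<close>.\<close>

lemma n_le:
  assumes "0 \<le> r" "r < 1"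
  shows "n r \<le> 4 * m (1/2) * r"
proof -
  let ?k = "4 * m (1/2)"
  have "n 0 - ?k * 0 \<ge> n r - ?k * r"
  proof (rule DERIV_nonpos_imp_decreasing_open[where f="\<lambda>s. n s - ?k * s", OF assms(1)])
    fix x assume x: "0 < x" "x < r"
    have "((\<lambda>s. n s - ?k * s) has_real_derivative x * V x - ?k) (at x)"
      using assms x by (auto intro!: derivative_eq_intros Dn)
    moreover have "x * V x \<le> ?k"
    proof -
      have "ln (1 / x) \<le> 1 / x" using ln_le_minus_one[of "1/x"] x by simp
      then have "?k * ln (1 / x) \<le> ?k * (1 / x)"
        using m_half_pos by (intro mult_left_mono) auto
      then have "x * V x \<le> x * (?k * (1 / x))"
        using V_le_log[of x] assms x by (intro mult_left_mono) auto
      then show ?thesis using x by simp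
    qed
    ultimately show "\<exists>y. ((\<lambda>s. n s - ?k * s) has_real_derivative y) (at x) \<and> y \<le> 0"
      by force
  qed (use assms in \<open>auto intro!: continuous_intros contn'\<close>)
  then show ?thesis by (simp add: n_0)
qed

lemma U_Lipschitz_at_0:
  assumes "0 \<le> r" "r \<le> 1"
  shows "U 0 \<le> U r + 4 * m (1/2) * r"
proof -
  let ?k = "4 * m (1/2)"
  have "U 0 + ?k * 0 \<le> U r + ?k * r"
  proof (rule DERIV_nonneg_imp_increasing_open[where f="\<lambda>s. U s + ?k * s", OF assms(1)])
    fix x assume x: "0 < x" "x < r"
    have "((\<lambda>s. U s + ?k * s) has_real_derivative - (n x / x) + ?k) (at x)"
      using assms x by (auto intro!: derivative_eq_intros DU)
    moreover have "n x / x \<le> ?k"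
      using n_le[of x] assms x by (simp add: field_simps)
    ultimately show "\<exists>y. ((\<lambda>s. U s + ?k * s) has_real_derivative y) (at x) \<and> 0 \<le> y"
      by force
  qed (use assms in \<open>auto intro!: continuous_intros contU'\<close>)
  then show ?thesis by simp
qed

lemma K_ge_128: "K \<ge> 128"
  by (rule total_mass_bound_ge[OF kappa])

lemma four_m_half_le: "4 * m (1/2) \<le> K"
  using m_half_le by simp

lemma U_0_le: "U 0 \<le> K"
  using U_Lipschitz_at_0[of 1] U_1 four_m_half_le by simp

text \<open>Radius 1/\<open>q\<close> is the right scale: the mass bound there gives
  \<open>U powr q\<close> of order \<open>q\<close>^2, and moving on to the centre raises
  \<open>U\<close> by at most \<open>K\<close> / \<open>q\<close>, which costs only the factor exp
  \<open>K\<close> in the power.\<close>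

lemma U_0_powr_le: "U 0 powr q \<le> 2 * K * q^2 * exp K"
proof -
  \<comment> \<open>The maximum with 1 allows the additive error \<open>K / q\<close> to be
    rewritten as a factor 1 + \<open>K / q\<close>.\<close>
  define X where "X = max (U (1/q)) 1"
  have r: "0 < 1/q" "1/q < 1" using q_gt_1 by auto
  have "m (1/q) \<ge> (1/q)^2 / 2 * U (1/q) powr q"
    using m_increment_ge[of 0 "1/q"] r m_0 by simp
  moreover have "m (1/q) \<le> K"
    using m_le[of "1/q"] four_m_half_le r by linarith
  ultimately have "(1/q)^2 / 2 * U (1/q) powr q \<le> K" by simp
  then have "U (1/q) powr q \<le> 2 * K * q^2"
    using q_gt_1 by (simp add: field_simps power2_eq_square)
  moreover have "1 \<le> 2 * K * q^2"
  proof -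
    have "1 * 1 \<le> (2 * K) * q^2" using K_ge_128 q_gt_1 by (intro mult_mono) auto
    then show ?thesis by simp
  qed
  ultimately have X: "X powr q \<le> 2 * K * q^2" unfolding X_def max_def by auto
  have "U 0 \<le> U (1/q) + 4 * m (1/2) * (1/q)"
    using U_Lipschitz_at_0[of "1/q"] r by simp
  also have "\<dots> \<le> X + K * (1/q)"
    using four_m_half_le r by (intro add_mono mult_right_mono) (auto simp: X_def)
  also have "\<dots> \<le> X * (1 + K / q)"
  proof -
    have "1 * (K / q) \<le> X * (K / q)"
      using K_ge_128 q_gt_1 by (intro mult_right_mono) (auto simp: X_def)
    then show ?thesis by (simp add: algebra_simps)
  qed
  also have "\<dots> \<le> X * exp (K / q)"
    by (intro mult_left_mono) (auto simp: X_def exp_ge_add_one_self)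
  finally have "U 0 powr q \<le> (X * exp (K / q)) powr q"
    using U_pos[of 0] q_gt_1 by (intro powr_mono2) auto
  also have "\<dots> = X powr q * exp (K / q) powr q"
    by (simp add: powr_mult)
  also have "exp (K / q) powr q = exp K"
    using q_gt_1 by (simp add: exp_powr_real)
  also have "X powr q * exp K \<le> 2 * K * q^2 * exp K"
    using X by (intro mult_right_mono) auto
  finally show ?thesis .
qed

text \<open>The line from 0 to 1 is split at 1/\<open>q\<close>. Outside, the mass bound yields the
  logarithm; inside, the mass is at most quadratic in the radius with coefficient
  \<open>U 0 powr q / 2\<close>, and the bound of order \<open>q\<close>^2 on this coefficient
  leaves a constant.\<close>

lemma V_0_le: "V 0 \<le> K * ln q + K * exp K / 2"
proof -
  have r: "0 < 1/q" "1/q < 1" using q_gt_1 by auto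
  let ?k = "U 0 powr q"
  have "V 0 + ?k * 0^2 / 4 \<le> V (1/q) + ?k * (1/q)^2 / 4"
  proof (rule DERIV_nonneg_imp_increasing_open[where f="\<lambda>s. V s + ?k * s^2 / 4"])
    fix x assume x: "0 < x" "x < 1/q"
    have x1: "x < 1" using x r by linarith
    have "((\<lambda>s. V s + ?k * s^2 / 4) has_real_derivative - (m x / x) + ?k * x / 2) (at x)"
      using x x1 by (auto intro!: derivative_eq_intros DV)
    moreover have "m x / x \<le> ?k * x / 2"
      using m_increment_le[of 0 x] x x1 m_0 by (simp add: field_simps power2_eq_square)
    ultimately show "\<exists>y. ((\<lambda>s. V s + ?k * s^2 / 4) has_real_derivative y) (at x) \<and> 0 \<le> y"
      by force
  qed (use r in \<open>auto intro!: continuous_intros contV'\<close>)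
  moreover have "V (1/q) \<le> K * ln q"
  proof -
    have "V (1/q) \<le> 4 * m (1/2) * ln q" using V_le_log[of "1/q"] r by simp
    also have "\<dots> \<le> K * ln q"
      using four_m_half_le q_gt_1 by (intro mult_right_mono) auto
    finally show ?thesis .
  qed
  moreover have "?k * (1/q)^2 / 4 \<le> K * exp K / 2"
    using U_0_powr_le q_gt_1 by (simp add: field_simps)
  ultimately show ?thesis by simp
qed

section \<open>Lower bounds\<close>

lemma m_half_ge: "m (1/2) \<ge> 1/4"
proof -
  have le: "U 0 \<le> 4 * m (1/2)" using U_Lipschitz_at_0[of 1] U_1 by simp
  have "m (1/2) \<le> U 0 powr q / 8"
    using m_increment_le[of 0 "1/2"] m_0 by (simp add: power2_eq_square)
  \<comment> \<open>A self-improving inequality that excludes small solutions: dividing by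
    \<open>U 0\<close> forces \<open>U 0 powr (q - 1)\<close> to be at least 2, hence
    \<open>U 0\<close> to be at least 1.\<close>
  then have "U 0 \<le> U 0 powr q / 2" using le by simp
  moreover have pos: "U 0 > 0" using U_pos by simp
  moreover have "U 0 powr q = U 0 powr (q - 1) * U 0"
    using pos by (simp add: powr_diff)
  ultimately have "2 \<le> U 0 powr (q - 1)" by simp
  then have "U 0 \<ge> 1"
    using pos powr_le1[of "q - 1" "U 0"] q_gt_1 by (cases "U 0 \<ge> 1") auto
  then show ?thesis using le by linarith
qed

text \<open>Up to radius 1/2, \<open>V\<close> is at least \<open>m (1/2) / 2\<close>, hence at
  least 1/8. So \<open>n x\<close> is at least x^2/16 and \<open>U\<close> has slope at most -x/16,
  which integrates to the term with 1/32.\<close>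

lemma U_decrease:
  assumes "0 \<le> a" "a \<le> b" "b \<le> 1/2"
  shows "U b + b^2/32 \<le> U a + a^2/32"
proof (rule DERIV_nonpos_imp_decreasing_open[where f="\<lambda>s. U s + s^2/32", OF assms(2)])
  fix x assume x: "a < x" "x < b"
  have x1: "0 < x" "x < 1" using x assms by linarith+
  have "V x \<ge> 1/8"
    using V_antimono[of x "1/2"] half_bounds(1) m_half_ge x assms by linarith
  then have "x^2/2 * V x \<ge> x^2/2 * (1/8)"
    by (intro mult_left_mono) auto
  then have "n x \<ge> x^2 / 16"
    using n_ge[of x] x1 by linarith
  then have "x / 16 \<le> n x / x"
    using x1 by (simp add: field_simps power2_eq_square)
  moreover have "((\<lambda>s. U s + s^2/32) has_real_derivative - (n x / x) + x/16) (at x)"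
    using x1 by (auto intro!: derivative_eq_intros DU)
  ultimately show "\<exists>y. ((\<lambda>s. U s + s^2/32) has_real_derivative y) (at x) \<and> y \<le> 0"
    by force
qed (use assms in \<open>auto intro!: continuous_intros contU'\<close>)

lemma V_0_ge: "V 0 \<ge> ln q / (16 * (1 + 4096 * K))"
proof -
  \<comment> \<open>The division by 2 only keeps the radius within [0, 1/2], where
    \<open>U_decrease\<close> applies; \<open>q * \<rho>^4\<close> becomes 1/16.\<close>
  define \<rho> where "\<rho> = q powr (-1/4) / 2"
  have "q powr (-1/4) \<le> 1" using powr_mono[of "-1/4" 0 q] q_gt_1 by simp
  then have r: "0 < \<rho>" "\<rho> \<le> 1/2" using q_gt_1 by (auto simp: \<rho>_def)
  have "\<rho>^4 = (q powr (-1/4))^4 / 16" by (simp add: \<rho>_def power_divide)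
  also have "(q powr (-1/4))^4 = 1 / q"
    using q_gt_1 by (simp add: powr_minus_divide power_divide powr_power)
  finally have r4: "q * \<rho>^4 = 1/16" using q_gt_1 by simp
  \<comment> \<open>Between \<open>\<rho>/2\<close> and \<open>\<rho>\<close> the profile drops by a factor \<open>1 + y\<close> with \<open>q y\<close> of order \<open>1 / \<rho>\<^sup>2\<close>, so by
    Bernoulli a fixed fraction of the mass lies inside radius \<open>\<rho>\<close>.\<close>
  define y where "y = 3 * \<rho>^2 / (128 * K)"
  have y: "y > 0" using r K_ge_128 by (simp add: y_def)
  have Urho: "U \<rho> > 0" "U \<rho> \<le> K"
    using U_pos[of \<rho>] U_antimono[of 0 \<rho>] U_0_le r by auto
  \<comment> \<open>The drop of \<open>U\<close> from \<open>\<rho>/2\<close> to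
    \<open>\<rho>\<close> is at least (\<open>\<rho>\<close>^2 - \<open>\<rho>\<close>^2/4)/32 = 3
    \<open>\<rho>\<close>^2/128. Since \<open>U \<rho> \<le> K\<close>, dividing by \<open>K\<close>
    converts it into the relative drop \<open>y\<close>.\<close>
  have "U \<rho> * (1 + y) \<le> U \<rho> + K * y"
    using Urho y by (simp add: algebra_simps mult_right_mono)
  also have "\<dots> = U \<rho> + 3 * \<rho>^2 / 128" using K_ge_128 by (simp add: y_def)
  also have "\<dots> \<le> U (\<rho>/2)"
    using U_decrease[of "\<rho>/2" \<rho>] r by (simp add: power_divide)
  finally have step: "U \<rho> * (1 + y) \<le> U (\<rho>/2)" .
  have "U \<rho> powr q * (q * y) \<le> U \<rho> powr q * (1 + y) powr q"
  proof (intro mult_left_mono)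
    have "1 + q * y \<le> (1 + y) powr q"
      using one_plus_mult_le_powr[of q y] y q_gt_1 by simp
    then show "q * y \<le> (1 + y) powr q" by simp
  qed auto
  also have "\<dots> = (U \<rho> * (1 + y)) powr q" using Urho y by (simp add: powr_mult)
  also have "\<dots> \<le> U (\<rho>/2) powr q"
    using step Urho y q_gt_1 by (intro powr_mono2) auto
  finally have U2: "U \<rho> powr q * (q * y) \<le> U (\<rho>/2) powr q" .
  have "m \<rho> \<ge> m (\<rho>/2)" using m_mono[of "\<rho>/2" \<rho>] r by simp
  moreover have "m (\<rho>/2) \<ge> \<rho>^2 / 8 * U (\<rho>/2) powr q"
    using m_increment_ge[of 0 "\<rho>/2"] r m_0 by (simp add: power_divide)
  moreover have "\<rho>^2 / 8 * (U \<rho> powr q * (q * y)) \<le> \<rho>^2 / 8 * U (\<rho>/2) powr q"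
    using U2 by (intro mult_left_mono) auto
  ultimately have "\<rho>^2 / 8 * (U \<rho> powr q * (q * y)) \<le> m \<rho>" by linarith
  moreover have "\<rho>^2 / 8 * (U \<rho> powr q * (q * y)) = U \<rho> powr q * (3 / (1024 * K)) * (q * \<rho>^4)"
    by (simp add: y_def power4_eq_xxxx power2_eq_square)
  ultimately have "U \<rho> powr q * (3 / (16384 * K)) \<le> m \<rho>" by (simp add: r4)
  then have "U \<rho> powr q \<le> 16384 * K / 3 * m \<rho>"
    using K_ge_128 by (simp add: field_simps)
  moreover have "m (1/2) - m \<rho> \<le> U \<rho> powr q / 8"
  proof -
    have "m (1/2) - m \<rho> \<le> ((1/2)^2 - \<rho>^2) / 2 * U \<rho> powr q"
      using r by (intro m_increment_le) auto
    also have "\<dots> \<le> 1/8 * U \<rho> powr q"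
      by (intro mult_right_mono) (auto simp: power2_eq_square)
    finally show ?thesis by simp
  qed
  moreover have "K * m \<rho> \<ge> 0" using K_ge_128 m_nonneg[of \<rho>] r by simp
  \<comment> \<open>The mass between \<open>\<rho>\<close> and 1/2 is at most
    \<open>U \<rho> powr q / 8\<close>, hence at most 16384 \<open>K\<close> / 24 times the mass
    inside \<open>\<rho>\<close>; 4096 is a generous rounding.\<close>
  ultimately have "1/4 \<le> (1 + 4096 * K) * m \<rho>"
    using m_half_ge by (simp add: algebra_simps)
  then have mrho: "m \<rho> \<ge> 1 / (4 * (1 + 4096 * K))"
    using K_ge_128 by (simp add: field_simps)
  have lnr: "ln (1 / \<rho>) = ln q / 4 + ln 2"
    using q_gt_1 by (simp add: \<rho>_def ln_div ln_powr ln_mult)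
  then have "ln q / 4 \<le> ln (1 / \<rho>)" by simp
  then have "1 / (4 * (1 + 4096 * K)) * (ln q / 4) \<le> m \<rho> * ln (1 / \<rho>)"
    using mrho q_gt_1 m_nonneg[of \<rho>] r by (intro mult_mono) auto
  also have "\<dots> \<le> V \<rho>" using V_ge_log[of \<rho>] r by simp
  also have "\<dots> \<le> V 0" using V_antimono[of 0 \<rho>] r by simp
  finally show ?thesis by simp
qed

end

section \<open>From classical solutions to radial profiles\<close>

lemma partial_deriv_along:
  assumes "has_partial_deriv_at i f (y + s *\<^sub>R axis i 1)"
  shows "((\<lambda>s. f (y + s *\<^sub>R axis i 1)) has_real_derivative partial_deriv i f (y + s *\<^sub>R axis i 1)) (at s)"
proof -
  have "((\<lambda>t. f ((y + s *\<^sub>R axis i 1) + t *\<^sub>R axis i 1)) has_real_derivative partial_deriv i f (y + s *\<^sub>R axis i 1)) (at 0)"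
    using assms unfolding has_partial_deriv_at_def partial_deriv_def
    by (simp add: DERIV_deriv_iff_field_differentiable)
  moreover have "(\<lambda>t. f ((y + s *\<^sub>R axis i 1) + t *\<^sub>R axis i 1)) = (\<lambda>t. f (y + (t + s) *\<^sub>R axis i 1))"
    by (simp add: algebra_simps)
  ultimately show ?thesis
    using DERIV_shift[of "\<lambda>s. f (y + s *\<^sub>R axis i 1)" _ 0 s] by simp
qed

text \<open>The mean value inequality for \<open>f\<close> minus its linear part. Using
  \<open>closed_segment 0 h\<close> treats both signs of \<open>h\<close> together.\<close>

lemma partial_increment_bound:
  assumes pd: "\<And>s. s \<in> closed_segment 0 h \<Longrightarrow> has_partial_deriv_at i f (y + s *\<^sub>R axis i 1)"
    and bd: "\<And>s. s \<in> closed_segment 0 h \<Longrightarrow> \<bar>partial_deriv i f (y + s *\<^sub>R axis i 1) - c\<bar> \<le> \<epsilon>"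
  shows "\<bar>f (y + h *\<^sub>R axis i 1) - f y - h * c\<bar> \<le> \<epsilon> * \<bar>h\<bar>"
proof -
  let ?g = "\<lambda>s. f (y + s *\<^sub>R axis i 1) - s * c"
  have "norm (?g h - ?g 0) \<le> \<epsilon> * norm (h - 0)"
  proof (rule field_differentiable_bound[where S="closed_segment 0 h"])
    fix s assume s: "s \<in> closed_segment 0 h"
    show "(?g has_real_derivative partial_deriv i f (y + s *\<^sub>R axis i 1) - c) (at s within closed_segment 0 h)"
      by (rule has_field_derivative_at_within)
         (auto intro!: derivative_eq_intros partial_deriv_along[OF pd[OF s]])
    show "norm (partial_deriv i f (y + s *\<^sub>R axis i 1) - c) \<le> \<epsilon>" using bd[OF s] by simp
  qed auto
  then show ?thesis by simp
qed

text \<open>\<open>C_k_on\<close> speaks only of the coordinate axes, whereas \<open>lap_at\<close>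
  asks for all frames. An increment along \<open>e\<close> is replaced by one leg parallel to each
  axis, and continuity keeps both partial derivatives close to their values at \<open>x\<close> on
  these legs.\<close>

lemma C1_directional_derivative:
  fixes f :: "real^2 \<Rightarrow> real"
  assumes "open S" "x \<in> S" and C1: "C_k_on 1 S f"
  shows "((\<lambda>t. f (x + t *\<^sub>R e)) has_real_derivative (\<Sum>i\<in>UNIV. e $ i * partial_deriv i f x)) (at 0)"
proof -
  let ?a = "axis 1 1 :: real^2" and ?b = "axis 2 1 :: real^2"
  let ?D = "\<Sum>i\<in>UNIV. e $ i * partial_deriv i f x"
  have pd: "has_partial_deriv_at i f y" if "y \<in> S" for i y
    using C1 that by simp
  have cont: "continuous_on S (partial_deriv i f)" for i
    using C1 by simp
  define N where "N = \<bar>e $ 1\<bar> + \<bar>e $ 2\<bar>"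
  have e: "e = (e $ 1) *\<^sub>R ?a + (e $ 2) *\<^sub>R ?b"
    by (simp add: vec_eq_iff forall_2 axis_def)
  have "\<forall>\<^sub>F t in at 0. dist ((f (x + t *\<^sub>R e) - f x) / t) ?D < \<epsilon>" if "\<epsilon> > 0" for \<epsilon>
  proof -
    \<comment> \<open>Adding 1 covers the case \<open>e = 0\<close>, where \<open>N\<close>
      vanishes.\<close>
    define \<epsilon>' where "\<epsilon>' = \<epsilon> / (N + 1)"
    have N: "N \<ge> 0" by (simp add: N_def)
    have e': "\<epsilon>' > 0" "\<epsilon>' * N < \<epsilon>" using that N by (auto simp: \<epsilon>'_def field_simps)
    obtain d where d: "d > 0" "ball x d \<subseteq> S"
      using assms(1,2) open_contains_ball by blast
    have "\<exists>di>0. \<forall>y\<in>S. dist y x < di \<longrightarrow> dist (partial_deriv i f y) (partial_deriv i f x) < \<epsilon>'" for i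
      using cont[of i] assms(2) e'(1) unfolding continuous_on_iff by blast
    then obtain di where di: "\<And>i. di i > 0"
      "\<And>i y. y \<in> S \<Longrightarrow> dist y x < di i \<Longrightarrow> dist (partial_deriv i f y) (partial_deriv i f x) < \<epsilon>'"
      by metis
    define \<delta> where "\<delta> = min d (min (di 1) (di 2))"
    have delta: "\<delta> > 0" using d di by (simp add: \<delta>_def)
    have inS: "y \<in> S" if "dist y x < \<delta>" for y
      using that d by (auto simp: \<delta>_def dist_commute)
    have near: "\<bar>partial_deriv i f y - partial_deriv i f x\<bar> \<le> \<epsilon>'" if "dist y x < \<delta>" for i y
      using di(2)[OF inS[OF that], of i] that exhaust_2[of i] by (auto simp: \<delta>_def dist_real_def)
    have "\<forall>\<^sub>F t::real in at 0. \<bar>t\<bar> < \<delta> / (N + 1)"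
      using delta N by (auto simp: eventually_at dist_real_def intro!: exI[of _ "\<delta> / (N + 1)"])
    moreover have "\<forall>\<^sub>F t::real in at 0. t \<noteq> 0" by (auto simp: eventually_at_filter)
    ultimately show ?thesis
    proof eventually_elim
      case (elim t)
      have tN: "\<bar>t\<bar> * N < \<delta>"
      proof -
        have "\<bar>t\<bar> * N \<le> \<bar>t\<bar> * (N + 1)" by (intro mult_left_mono) auto
        also have "\<dots> < \<delta>" using elim(1) N by (simp add: field_simps)
        finally show ?thesis .
      qed
      have close: "dist (x + r *\<^sub>R ?a + s *\<^sub>R ?b) x < \<delta>"
        if "r \<in> closed_segment 0 (t * e $ 1)" "s \<in> closed_segment 0 (t * e $ 2)" for r s
      proof -
        have "\<bar>r\<bar> \<le> \<bar>t\<bar> * \<bar>e $ 1\<bar>" "\<bar>s\<bar> \<le> \<bar>t\<bar> * \<bar>e $ 2\<bar>"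
          using that by (auto simp: closed_segment_eq_real_ivl abs_mult[symmetric] split: if_splits)
        then have "\<bar>r\<bar> + \<bar>s\<bar> \<le> \<bar>t\<bar> * N" by (simp add: N_def distrib_left)
        moreover have "dist (x + r *\<^sub>R ?a + s *\<^sub>R ?b) x \<le> \<bar>r\<bar> + \<bar>s\<bar>"
          using norm_triangle_ineq[of "r *\<^sub>R ?a" "s *\<^sub>R ?b"] by (simp add: dist_norm norm_axis_1)
        ultimately show ?thesis using tN by linarith
      qed
      have 1: "\<bar>f (x + (t * e $ 1) *\<^sub>R ?a) - f x - (t * e $ 1) * partial_deriv 1 f x\<bar> \<le> \<epsilon>' * \<bar>t * e $ 1\<bar>"
        by (rule partial_increment_bound) (use close[of _ 0] inS pd near in auto)
      have 2: "\<bar>f (x + (t * e $ 1) *\<^sub>R ?a + (t * e $ 2) *\<^sub>R ?b) - f (x + (t * e $ 1) *\<^sub>R ?a) - (t * e $ 2) * partial_deriv 2 f x\<bar>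
           \<le> \<epsilon>' * \<bar>t * e $ 2\<bar>"
        by (rule partial_increment_bound) (use close[of "t * e $ 1"] inS pd near in auto)
      have te: "x + t *\<^sub>R e = x + (t * e $ 1) *\<^sub>R ?a + (t * e $ 2) *\<^sub>R ?b"
        by (subst e) (simp add: scaleR_right_distrib)
      have D: "t * ?D = (t * e $ 1) * partial_deriv 1 f x + (t * e $ 2) * partial_deriv 2 f x"
        by (simp add: sum_2 algebra_simps)
      have "\<bar>f (x + t *\<^sub>R e) - f x - t * ?D\<bar> \<le> \<epsilon>' * \<bar>t * e $ 1\<bar> + \<epsilon>' * \<bar>t * e $ 2\<bar>"
        using 1 2 unfolding te D by linarith
      also have "\<dots> = (\<epsilon>' * N) * \<bar>t\<bar>" by (simp add: N_def abs_mult algebra_simps)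
      also have "\<dots> < \<epsilon> * \<bar>t\<bar>" using e'(2) elim(2) by (intro mult_strict_right_mono) auto
      finally have "\<bar>f (x + t *\<^sub>R e) - f x - t * ?D\<bar> / \<bar>t\<bar> < \<epsilon>" using elim(2) by (simp add: divide_less_eq)
      moreover have "dist ((f (x + t *\<^sub>R e) - f x) / t) ?D = \<bar>f (x + t *\<^sub>R e) - f x - t * ?D\<bar> / \<bar>t\<bar>"
      proof -
        have "(f (x + t *\<^sub>R e) - f x) / t - ?D = (f (x + t *\<^sub>R e) - f x - t * ?D) / t"
          using elim(2) by (simp add: diff_divide_distrib)
        then show ?thesis by (simp add: dist_real_def)
      qed
      ultimately show ?case by simp
    qed
  qed
  then have "((\<lambda>t. (f (x + t *\<^sub>R e) - f x) / t) \<longlongrightarrow> ?D) (at 0)" by (rule tendstoI)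
  then show ?thesis by (simp add: has_field_derivative_iff)
qed

lemma C_k_on_2D:
  assumes "C_k_on 2 S f"
  shows "C_k_on 1 S f" "C_k_on 1 S (partial_deriv i f)"
  using assms by (auto simp: numeral_2_eq_2)

lemma C1_line_derivative:
  fixes f :: "real^2 \<Rightarrow> real"
  assumes "open S" "x + t *\<^sub>R e \<in> S" and C1: "C_k_on 1 S f"
  shows "((\<lambda>t. f (x + t *\<^sub>R e)) has_real_derivative (\<Sum>i\<in>UNIV. e $ i * partial_deriv i f (x + t *\<^sub>R e))) (at t)"
proof -
  have "(\<lambda>s. f ((x + t *\<^sub>R e) + s *\<^sub>R e)) = (\<lambda>s. f (x + (s + t) *\<^sub>R e))"
    by (simp add: algebra_simps)
  then show ?thesis
    using C1_directional_derivative[OF assms, of e] DERIV_shift[of "\<lambda>t. f (x + t *\<^sub>R e)" _ 0 t] by simp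
qed

text \<open>Summed over a frame, each pure second derivative gets coefficient 1 and each mixed one
  gets e1 e2 + e'1 e'2 = 0, by orthonormality of the columns.\<close>

lemma C2_lap_at:
  fixes f :: "real^2 \<Rightarrow> real"
  assumes S: "open S" "x \<in> S" and C2: "C_k_on 2 S f"
  shows "lap_at f x (laplacian f x)"
proof -
  obtain \<delta> where d: "\<delta> > 0" "ball x \<delta> \<subseteq> S" using S open_contains_ball by blast
  show ?thesis
  proof (rule lap_atI[OF d(1), where D="\<lambda>e t. \<Sum>i\<in>UNIV. e $ i * partial_deriv i f (x + t *\<^sub>R e)"
        and E="\<lambda>e. \<Sum>i\<in>UNIV. e $ i * (\<Sum>j\<in>UNIV. e $ j * partial_deriv j (partial_deriv i f) x)"])
    fix e :: "real^2" and t :: real assume e: "norm e = 1"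
    show "((\<lambda>t. f (x + t *\<^sub>R e)) has_real_derivative (\<Sum>i\<in>UNIV. e $ i * partial_deriv i f (x + t *\<^sub>R e))) (at t)"
      if "\<bar>t\<bar> < \<delta>"
      using that e d by (intro C1_line_derivative[OF S(1)] C_k_on_2D(1)[OF C2]) (auto simp: dist_norm)
    show "((\<lambda>t. \<Sum>i\<in>UNIV. e $ i * partial_deriv i f (x + t *\<^sub>R e)) has_real_derivative
       (\<Sum>i\<in>UNIV. e $ i * (\<Sum>j\<in>UNIV. e $ j * partial_deriv j (partial_deriv i f) x))) (at 0)"
      by (intro DERIV_sum DERIV_cmult C1_directional_derivative[OF S] C_k_on_2D(2)[OF C2])
  next
    fix e e' :: "real^2" assume e: "norm e = 1" "norm e' = 1" "e \<bullet> e' = 0"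
    have 1: "e$1 * e$1 + e$2 * e$2 = 1" "e'$1 * e'$1 + e'$2 * e'$2 = 1" "e$1 * e'$1 + e$2 * e'$2 = 0"
      using e by (simp_all add: norm_eq_1 inner_vec_def sum_2)
    have "e$1 * e$1 + e'$1 * e'$1 = 1" "e$2 * e$2 + e'$2 * e'$2 = 1" "e$1 * e$2 + e'$1 * e'$2 = 0"
      using 1 by algebra+
    then have "e$1 * (e$1 * A + e$2 * B) + e$2 * (e$1 * C + e$2 * D)
       + (e'$1 * (e'$1 * A + e'$2 * B) + e'$2 * (e'$1 * C + e'$2 * D)) = A + D" for A B C D
      by algebra
    then show "(\<Sum>i\<in>UNIV. e $ i * (\<Sum>j\<in>UNIV. e $ j * partial_deriv j (partial_deriv i f) x)) +
       (\<Sum>i\<in>UNIV. e' $ i * (\<Sum>j\<in>UNIV. e' $ j * partial_deriv j (partial_deriv i f) x)) = laplacian f x"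
      by (simp add: laplacian_def sum_2)
  qed
qed

text \<open>In the frame of radial and tangential directions, the radial line contributes
  \<open>c\<close>. On the tangential line the distance to the centre is sqrt(r^2 + h^2), and the
  second derivative of the profile along it at h = 0 is \<open>F' r / r\<close>.\<close>

lemma radial_laplacian:
  fixes f :: "real^2 \<Rightarrow> real"
  defines "a \<equiv> axis 1 1"
  assumes lap: "lap_at f (r *\<^sub>R a) l" and r: "0 < r" "r < 1"
    and radial: "\<And>x y. norm x = norm y \<Longrightarrow> norm x < 1 \<Longrightarrow> f x = f y"
    and F1: "\<And>s. \<bar>s\<bar> < 1 \<Longrightarrow> ((\<lambda>s. f (s *\<^sub>R a)) has_real_derivative F' s) (at s)"
    and F2: "(F' has_real_derivative c) (at r)"
  shows "l = c + F' r / r"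
proof -
  let ?F = "\<lambda>s. f (s *\<^sub>R a)"
  define b :: "real^2" where "b = axis 2 1"
  have ab: "norm a = 1" "norm b = 1" "a \<bullet> b = 0"
    by (auto simp: a_def b_def norm_axis_1 inner_axis_axis)
  \<comment> \<open>Keeps both test lines inside the disk and the points \<open>r + h\<close> of the
    radial one on the positive side of the centre.\<close>
  define \<delta> where "\<delta> = min r (1 - r)"
  have d: "\<delta> > 0" using r by (simp add: \<delta>_def)
  have small: "r^2 + h^2 < 1" if "\<bar>h\<bar> < \<delta>" for h
  proof -
    have "h^2 = \<bar>h\<bar> * \<bar>h\<bar>" by (simp add: power2_eq_square)
    also have "\<dots> \<le> \<bar>h\<bar> * (1 - r)" using that by (intro mult_left_mono) (auto simp: \<delta>_def)
    also have "\<dots> \<le> (1 - r) * 1" using that r by (simp add: \<delta>_def mult.commute mult_left_le)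
    moreover have "r^2 < r * 1" unfolding power2_eq_square using r by (intro mult_strict_left_mono) auto
    ultimately show ?thesis by simp
  qed
  have sq: "f (r *\<^sub>R a + h *\<^sub>R b) = ?F (sqrt (r^2 + h^2))" if "\<bar>h\<bar> < \<delta>" for h
  proof (rule radial)
    have "(norm (r *\<^sub>R a + h *\<^sub>R b))\<^sup>2 = r^2 + h^2"
      using ab unfolding power2_norm_eq_inner norm_eq_1
      by (simp add: inner_simps inner_commute power2_eq_square)
    then have "norm (r *\<^sub>R a + h *\<^sub>R b) = sqrt (r^2 + h^2)" by (metis norm_ge_zero real_sqrt_unique)
    then show "norm (r *\<^sub>R a + h *\<^sub>R b) = norm (sqrt (r^2 + h^2) *\<^sub>R a)" "norm (r *\<^sub>R a + h *\<^sub>R b) < 1"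
      using ab small[OF that] by auto
  qed
  have A: "((\<lambda>h. (?F (r + h) + ?F (r + - h) - 2 * ?F (r + 0)) / h^2) \<longlongrightarrow> c) (at 0)"
  proof (rule symmetric_second_difference[OF d, where \<phi>'="\<lambda>h. F' (r + h)"])
    show "((\<lambda>h. ?F (r + h)) has_real_derivative F' (r + t)) (at t)" if "\<bar>t\<bar> < \<delta>" for t
    proof -
      have "(?F has_real_derivative F' (t + r)) (at (t + r))"
        using that r by (intro F1) (auto simp: \<delta>_def)
      then show ?thesis unfolding DERIV_shift by (simp only: add.commute)
    qed
    show "((\<lambda>h. F' (r + h)) has_real_derivative c) (at 0)"
      using F2 DERIV_shift[of F' c 0 r] by (simp add: add.commute[of r])
  qed
  have B: "((\<lambda>h. (?F (sqrt (r^2 + h^2)) + ?F (sqrt (r^2 + (- h)^2)) - 2 * ?F (sqrt (r^2 + 0^2))) / h^2) \<longlongrightarrow> F' r / r) (at 0)"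
  proof (rule symmetric_second_difference[OF d, where \<phi>'="\<lambda>h. F' (sqrt (r^2 + h^2)) * (h / sqrt (r^2 + h^2))"])
    fix t assume t: "\<bar>t\<bar> < \<delta>"
    have pos: "r^2 + t^2 > 0" using r by (simp add: add_pos_nonneg)
    have "((\<lambda>h. sqrt (r^2 + h^2)) has_real_derivative t / sqrt (r^2 + t^2)) (at t)"
      using pos by (auto intro!: derivative_eq_intros simp: field_simps)
    moreover have "(?F has_real_derivative F' (sqrt (r^2 + t^2))) (at (sqrt (r^2 + t^2)))"
      using small[OF t] pos by (intro F1) simp
    ultimately show "((\<lambda>h. ?F (sqrt (r^2 + h^2))) has_real_derivative F' (sqrt (r^2 + t^2)) * (t / sqrt (r^2 + t^2))) (at t)"
      by (rule DERIV_chain2[rotated])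
  next
    have "((\<lambda>h. sqrt (r^2 + h^2)) has_real_derivative 0) (at 0)"
      using r by (auto intro!: derivative_eq_intros simp: field_simps)
    moreover have "(F' has_real_derivative c) (at (sqrt (r^2 + 0^2)))" using F2 r by simp
    ultimately have 1: "((\<lambda>h. F' (sqrt (r^2 + h^2))) has_real_derivative c * 0) (at 0)"
      by (rule DERIV_chain2[rotated])
    have 2: "((\<lambda>h. h / sqrt (r^2 + h^2)) has_real_derivative 1 / r) (at 0)"
      using r by (auto intro!: derivative_eq_intros simp: field_simps)
    show "((\<lambda>h. F' (sqrt (r^2 + h^2)) * (h / sqrt (r^2 + h^2))) has_real_derivative F' r / r) (at 0)"
      by (rule DERIV_cong[OF DERIV_mult[OF 1 2]]) (use r in simp)
  qed
  have "((\<lambda>h. (f (r *\<^sub>R a + h *\<^sub>R a) + f (r *\<^sub>R a - h *\<^sub>R a) + f (r *\<^sub>R a + h *\<^sub>R b) + f (r *\<^sub>R a - h *\<^sub>R b) - 4 * f (r *\<^sub>R a)) / h^2)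
        \<longlongrightarrow> c + F' r / r) (at 0)"
  proof (rule filterlim_cong[THEN iffD1, OF refl refl _ tendsto_add[OF A B]])
    have "\<forall>\<^sub>F h in at 0. \<bar>h\<bar> < \<delta>"
      using d by (auto simp: eventually_at dist_real_def)
    then show "\<forall>\<^sub>F h in at 0. (?F (r + h) + ?F (r + - h) - 2 * ?F (r + 0)) / h^2
        + (?F (sqrt (r^2 + h^2)) + ?F (sqrt (r^2 + (- h)^2)) - 2 * ?F (sqrt (r^2 + 0^2))) / h^2
       = (f (r *\<^sub>R a + h *\<^sub>R a) + f (r *\<^sub>R a - h *\<^sub>R a) + f (r *\<^sub>R a + h *\<^sub>R b) + f (r *\<^sub>R a - h *\<^sub>R b) - 4 * f (r *\<^sub>R a)) / h^2"
    proof eventually_elim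
      case (elim h)
      have "f (r *\<^sub>R a - h *\<^sub>R b) = ?F (sqrt (r^2 + h^2))"
        using sq[of "- h"] elim by simp
      moreover have "r *\<^sub>R a + h *\<^sub>R a = (r + h) *\<^sub>R a" "r *\<^sub>R a - h *\<^sub>R a = (r + - h) *\<^sub>R a"
        by (simp_all add: algebra_simps)
      ultimately show ?case
        using sq[OF elim] r by (simp add: add_divide_distrib diff_divide_distrib)
    qed
  qed
  from lap_at_unique[OF lap ab this] show ?thesis by simp
qed

section \<open>Essential suprema of continuous functions on open sets\<close>

lemma Linf_norm_le:
  fixes f :: "real^2 \<Rightarrow> real"
  assumes "open S" "continuous_on S f" "\<And>x. x \<in> S \<Longrightarrow> \<bar>f x\<bar> \<le> c"
  shows "Linf_norm S f \<le> ereal c"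
  unfolding Linf_norm_def
proof (rule esssup_I)
  have "f \<in> borel_measurable (lebesgue_on S)"
    using assms(1,2) by (intro continuous_imp_measurable_on_sets_lebesgue) auto
  then show "(\<lambda>x. ereal \<bar>f x\<bar>) \<in> borel_measurable (lebesgue_on S)" by measurable
  show "AE x in lebesgue_on S. ereal \<bar>f x\<bar> \<le> ereal c"
    using assms(3) by (intro AE_I2) auto
qed

text \<open>If the value at \<open>x\<close> exceeded the essential supremum, the points exceeding
  an intermediate level would form a nonempty open set, which cannot be null.\<close>

lemma Linf_norm_ge:
  fixes f :: "real^2 \<Rightarrow> real"
  assumes S: "open S" and cont: "continuous_on S f" and x: "x \<in> S"
  shows "ereal \<bar>f x\<bar> \<le> Linf_norm S f"
proof (rule ccontr)
  assume "\<not> ereal \<bar>f x\<bar> \<le> Linf_norm S f"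
  then have less: "Linf_norm S f < ereal \<bar>f x\<bar>" by simp
  then obtain c where c: "Linf_norm S f < ereal c" "ereal c < ereal \<bar>f x\<bar>"
    using ereal_dense2 by blast
  define T where "T = {y \<in> S. c < \<bar>f y\<bar>}"
  have "open ((\<lambda>y. \<bar>f y\<bar>) -` {c<..} \<inter> S)"
    using continuous_on_rabs[OF cont] unfolding continuous_on_open_vimage[OF S] by simp
  moreover have "(\<lambda>y. \<bar>f y\<bar>) -` {c<..} \<inter> S = T" by (auto simp: T_def)
  ultimately have "open T" by simp
  moreover have "x \<in> T" using c x by (simp add: T_def)
  ultimately have "\<not> negligible T" using open_not_negligible by blast
  moreover have "AE y in lebesgue_on S. ereal \<bar>f y\<bar> \<le> Linf_norm S f"
    unfolding Linf_norm_def by (rule esssup_AE)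
  then have "AE y in lebesgue. y \<in> S \<longrightarrow> ereal \<bar>f y\<bar> \<le> Linf_norm S f"
    using S by (subst (asm) AE_restrict_space_iff) auto
  then have "AE y in lebesgue. y \<notin> T"
  proof eventually_elim
    case (elim y)
    then show ?case using c by (auto simp: T_def dest: order.strict_trans1)
  qed
  then have "negligible T"
    using \<open>open T\<close> by (auto simp: negligible_iff_null_sets AE_iff_null_sets[of T lebesgue])
  ultimately show False by blast
qed

lemma classical_solution_disk_solution:
  assumes q: "q > 1" and sol: "classical_solution q unit_disk u v"
  shows "disk_solution q u v"
proof
  have cl: "closure (unit_disk) = cball 0 1" "frontier (unit_disk) = sphere 0 1"
    by (auto simp: frontier_ball)
  note s = sol[unfolded classical_solution_def cl]
  show "continuous_on (cball 0 1) u" "continuous_on (cball 0 1) v" using s by auto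
  show "lap_at u x (- v x)" if "x \<in> ball 0 1" for x
  proof -
    have "laplacian u x = - v x" using s that by (metis minus_minus)
    then show ?thesis using C2_lap_at[OF open_ball that, of u] s by simp
  qed
  show "lap_at v x (- (u x powr q))" if "x \<in> ball 0 1" for x
  proof -
    have "laplacian v x = - (u x powr q)" using s that by (metis minus_minus)
    then show ?thesis using C2_lap_at[OF open_ball that, of v] s by simp
  qed
  show "u x > 0" "v x > 0" if "x \<in> ball 0 1" for x using s that by auto
  show "u x = 0" "v x = 0" if "norm x = 1" for x using s that by auto
qed (rule q)

text \<open>Along the first axis the first partial derivative is the radial derivative
  \<open>d\<close>. Multiplying d' + d/r = -g by r puts the equation in divergence form, with the
  mass -r \<open>d\<close> as unknown: this is the system required by
  \<open>radial_profile\<close>.\<close>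

lemma radial_ode:
  fixes f :: "real^2 \<Rightarrow> real"
  defines "a \<equiv> axis 1 1" and "d \<equiv> \<lambda>s. partial_deriv 1 f (s *\<^sub>R axis 1 1)"
  assumes C2: "C_k_on 2 (ball 0 1) f"
    and radial: "\<And>x y. norm x = norm y \<Longrightarrow> norm x < 1 \<Longrightarrow> f x = f y"
    and lap: "\<And>x. x \<in> ball 0 1 \<Longrightarrow> lap_at f x (- g x)"
  shows "continuous_on {0..<1} (\<lambda>r. - (r * d r))"
    and "\<And>r. 0 < r \<Longrightarrow> r < 1 \<Longrightarrow> ((\<lambda>r. f (r *\<^sub>R a)) has_real_derivative - (- (r * d r) / r)) (at r)"
    and "\<And>r. 0 < r \<Longrightarrow> r < 1 \<Longrightarrow> ((\<lambda>r. - (r * d r)) has_real_derivative r * g (r *\<^sub>R a)) (at r)"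
proof -
  have a: "norm a = 1" by (simp add: a_def norm_axis_1)
  have F1: "((\<lambda>s. f (s *\<^sub>R a)) has_real_derivative d s) (at s)" if "\<bar>s\<bar> < 1" for s
    using partial_deriv_along[of 1 f 0 s] C_k_on_2D(1)[OF C2] that a by (simp add: a_def d_def)
  have F2: "\<exists>c. (d has_real_derivative c) (at s)" if "\<bar>s\<bar> < 1" for s
    using partial_deriv_along[of 1 "partial_deriv 1 f" 0 s] C_k_on_2D(2)[OF C2, of 1] that a
    by (auto simp: a_def d_def)
  have "isCont d s" if "\<bar>s\<bar> < 1" for s using F2[OF that] DERIV_isCont by blast
  then have "continuous_on {0..<1} d" by (intro continuous_at_imp_continuous_on) auto
  then show "continuous_on {0..<1} (\<lambda>r. - (r * d r))" by (intro continuous_intros)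
  fix r :: real assume r: "0 < r" "r < 1"
  show "((\<lambda>r. f (r *\<^sub>R a)) has_real_derivative - (- (r * d r) / r)) (at r)"
    using F1[of r] r by simp
  obtain c where c: "(d has_real_derivative c) (at r)" using F2[of r] r by auto
  have "lap_at f (r *\<^sub>R axis 1 1) (- g (r *\<^sub>R a))"
    using lap[of "r *\<^sub>R a"] r a by (simp add: a_def)
  then have "- g (r *\<^sub>R a) = c + d r / r"
    by (rule radial_laplacian[OF _ r radial _ c]) (use F1 in \<open>auto simp: a_def\<close>)
  then have "r * g (r *\<^sub>R a) = - (d r + r * c)" using r by (simp add: field_simps)
  then show "((\<lambda>r. - (r * d r)) has_real_derivative r * g (r *\<^sub>R a)) (at r)"
    by (auto intro!: derivative_eq_intros c)
qed

theorem theorem1p2: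
  fixes \<kappa> :: real
  assumes "\<kappa> > 0"
  shows "\<exists>C::real. C \<ge> 1 \<and>
    (\<forall>q::real. q \<ge> 1 + \<kappa> \<longrightarrow>
      (\<forall>u v. classical_solution q unit_disk u v \<longrightarrow>
        Linf_norm unit_disk u \<le> ereal C \<and>
        ereal (inverse C * ln q) \<le> Linf_norm unit_disk v \<and>
        Linf_norm unit_disk v \<le> ereal (C * ln q)))"
proof -
  define K where "K = total_mass_bound \<kappa>"
  have K: "K \<ge> 128" unfolding K_def by (rule total_mass_bound_ge[OF assms])
  \<comment> \<open>Absorbs the additive term of the upper bound for \<open>v 0\<close>:
    \<open>T * ln (1 + \<kappa>)\<close> equals K exp K / 2, and \<open>ln q\<close> is at least
    \<open>ln (1 + \<kappa>)\<close>.\<close>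
  define T where "T = K * exp K / (2 * ln (1 + \<kappa>))"
  have T: "T \<ge> 0" using K assms by (simp add: T_def)
  \<comment> \<open>The sum dominates each constant required: \<open>K\<close> for u,
    \<open>K + T\<close> for the upper bound on v, and the denominator of its lower bound.\<close>
  define C where "C = K + T + 16 * (1 + 4096 * K)"
  show ?thesis
  proof (intro exI[of _ C] conjI allI impI)
    show "C \<ge> 1" using K T by (simp add: C_def)
    fix q u v assume q: "q \<ge> 1 + \<kappa>" and sol: "classical_solution q unit_disk u v"
    have q1: "q > 1" using q assms by simp
    note hq = q
    interpret disk_solution q u v by (rule classical_solution_disk_solution[OF q1 sol])
    have C2: "C_k_on 2 unit_disk u" "C_k_on 2 unit_disk v"
      using sol by (auto simp: classical_solution_def)
    let ?a = "axis 1 1 :: real^2"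
    have a: "norm ?a = 1" by (simp add: norm_axis_1)
    have contr: "continuous_on {0..1} (\<lambda>r. f (r *\<^sub>R ?a))" if "continuous_on (cball 0 1) f" for f :: "real^2 \<Rightarrow> real"
      by (rule continuous_on_compose2[OF that]) (auto intro!: continuous_intros simp: a)
    note ode_u = radial_ode[OF C2(1) radial(1) lap_u] and ode_v = radial_ode[OF C2(2) radial(2) lap_v]
    interpret p: radial_profile q \<kappa> "\<lambda>r. u (r *\<^sub>R ?a)" "\<lambda>r. v (r *\<^sub>R ?a)"
      "\<lambda>r. - (r * partial_deriv 1 v (r *\<^sub>R ?a))" "\<lambda>r. - (r * partial_deriv 1 u (r *\<^sub>R ?a))"
    proof
      show "0 < \<kappa>" "1 + \<kappa> \<le> q" by (fact assms hq)+
      show "continuous_on {0..1} (\<lambda>r. u (r *\<^sub>R ?a))" "continuous_on {0..1} (\<lambda>r. v (r *\<^sub>R ?a))"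
        by (rule contr[OF cont_u] contr[OF cont_v])+
      show "0 < u (r *\<^sub>R ?a)" "0 < v (r *\<^sub>R ?a)" if "0 \<le> r" "r < 1" for r
        using that a by (auto intro!: u_pos v_pos)
      show "u (1 *\<^sub>R ?a) = 0" "v (1 *\<^sub>R ?a) = 0" using u_0 v_0 a by auto
    qed (use ode_u ode_v in auto)
    have bound: "\<bar>u x\<bar> \<le> u 0" "\<bar>v x\<bar> \<le> v 0" if "x \<in> unit_disk" for x
    proof -
      have "u x = u (norm x *\<^sub>R ?a)" "v x = v (norm x *\<^sub>R ?a)"
        using that a by (auto intro: radial)
      then show "\<bar>u x\<bar> \<le> u 0" "\<bar>v x\<bar> \<le> v 0"
        using p.U_antimono[of 0 "norm x"] p.V_antimono[of 0 "norm x"] u_pos[OF that] v_pos[OF that] that by auto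
    qed
    have cont: "continuous_on unit_disk u" "continuous_on unit_disk v"
      using continuous_on_subset[OF cont_u ball_subset_cball] continuous_on_subset[OF cont_v ball_subset_cball] by auto
    have lnq: "ln q \<ge> ln (1 + \<kappa>)" "ln (1 + \<kappa>) > 0" using hq assms by auto
    have u0: "u 0 \<le> C" using p.U_0_le K T by (simp add: C_def K_def)
    show "Linf_norm unit_disk u \<le> ereal C"
      by (rule Linf_norm_le[OF open_ball cont(1)]) (use bound(1) u0 in force)
    have "v 0 \<le> K * ln q + K * exp K / 2" using p.V_0_le by (simp add: K_def)
    also have "K * exp K / 2 = T * ln (1 + \<kappa>)" using lnq by (simp add: T_def)
    also have "\<dots> \<le> T * ln q" using T lnq by (intro mult_left_mono) auto
    also have "K * ln q + T * ln q = (K + T) * ln q" by (simp add: algebra_simps)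
    also have "\<dots> \<le> C * ln q" using K lnq by (intro mult_right_mono) (auto simp: C_def)
    finally have v0: "v 0 \<le> C * ln q" by simp
    show "Linf_norm unit_disk v \<le> ereal (C * ln q)"
      by (rule Linf_norm_le[OF open_ball cont(2)]) (use bound(2) v0 in force)
    have "inverse C * ln q \<le> inverse (16 * (1 + 4096 * K)) * ln q"
      using K T lnq by (intro mult_right_mono le_imp_inverse_le) (auto simp: C_def)
    also have "\<dots> = ln q / (16 * (1 + 4096 * K))" by (simp add: divide_inverse)
    also have "\<dots> \<le> \<bar>v 0\<bar>" using p.V_0_ge by (simp add: K_def)
    finally have "ereal (inverse C * ln q) \<le> ereal \<bar>v 0\<bar>" by simp
    also have "\<dots> \<le> Linf_norm unit_disk v"
      by (rule Linf_norm_ge[OF open_ball cont(2)]) simp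
    finally show "ereal (inverse C * ln q) \<le> Linf_norm unit_disk v" .
  qed
qed

end
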